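(* Let $\alpha=1$ and let $\phi_1(t)=t^{-1/2}(\log t)^{-1/2}$. Then $\mathbf{P}$-almost surely, \[\limsup_{t\to\infty}\frac{p_t^\omega(0,0)}{\phi_1(t)}\in(0,\infty),\] and \[\liminf_{t\to\infty}\frac{p_t^\omega(0,0)\,(\log\log t)^{\theta}}{\phi_1(t)}=0 \text{ if } \theta=\tfrac12,\qquad \liminf_{t\to\infty}\frac{p_t^\omega(0,0)\,(\log\log t)^{\theta}}{\phi_1(t)}=\infty \text{ if } \theta>3.\]
   Context: One-dimensional symmetric Bouchaud trap model. Fix $\alpha>0$. Let $\tau=\{\tau_x\}_{x\in\mathbb{Z}}$ be i.i.d. random variables (the random environment, with law $\mathbf{P}$ and expectation $\mathbf{E}$; $\omega$ denotes a realisation of the environment) with $\mathbf{P}(\tau_x>u)=u^{-\alpha}$ for all $u\ge 1$. Given $\tau$, let $X=(X_t)_{t\ge0}$ be the continuous-time Markov chain on $\mathbb{Z}$ with generator $\mathcal{L}f(x)=\frac{1}{2\tau_x}\sum_{y\sim x}(f(y)-f(x))$ (sum over the two nearest neighbours of $x$); i.e. $X$ waits at $x$ an exponential time with mean $\tau_x$ and then jumps to a uniformly chosen neighbour. Write $P^\omega_x$ for the quenched law of $X$ started at $x$. The measure $\sum_x\tau_x\delta_x$ is reversible/invariant for $X$, and the quenched heat kernel is $p_t^\omega(x,y)=P^\omega_x(X_t=y)/\tau_y$. *)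

theory Defs
  imports "HOL-Probability.Probability"
begin

text \<open>Generator of the symmetric Bouchaud trap model in environment e (e x = tau_x):
  L f(x) = 1/(2 e x) * sum over neighbours y of (f y - f x). Matrix entries L(x,y).\<close>
definition trap_gen :: "(int \<Rightarrow> real) \<Rightarrow> int \<Rightarrow> int \<Rightarrow> real" where
  "trap_gen e x y =
     (if y = x + 1 \<or> y = x - 1 then 1 / (2 * e x)
      else if y = x then - 1 / e x else 0)"

text \<open>Matrix powers L^n(x,y) (L is tridiagonal, so the sums are finite).\<close>
fun trap_gen_pow :: "(int \<Rightarrow> real) \<Rightarrow> nat \<Rightarrow> int \<Rightarrow> int \<Rightarrow> real" where
  "trap_gen_pow e 0 x y = (if x = y then 1 else 0)"
| "trap_gen_pow e (Suc n) x y = (\<Sum>z\<in>{x - 1..x + 1}. trap_gen e x z * trap_gen_pow e n z y)"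

text \<open>Quenched transition probability P_x(X_t = y) = (exp (t L))(x,y); the rates are
  bounded (tau \<ge> 1), so the semigroup is given by the exponential series.\<close>
definition trap_trans :: "(int \<Rightarrow> real) \<Rightarrow> real \<Rightarrow> int \<Rightarrow> int \<Rightarrow> real" where
  "trap_trans e t x y = (\<Sum>n. t ^ n / fact n * trap_gen_pow e n x y)"

definition trap_heat_kernel :: "(int \<Rightarrow> real) \<Rightarrow> real \<Rightarrow> int \<Rightarrow> int \<Rightarrow> real" where
  "trap_heat_kernel e t x y = trap_trans e t x y / e y"

definition phi1 :: "real \<Rightarrow> real" where
  "phi1 t = t powr (-1/2) * ln t powr (-1/2)"

end

(* Write T = I + L/2 for the lazy chain, q_n(x) = T^n(delta_0/e_0)(x) for its kernel and S(n) for a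
   one-sided sum of n traps. Then p_t(0,0) is the mixture of the q_n(0) over a Poisson(2t) variable.

   Upper bound: q_n is at most 1/S(r) somewhere on {0,...,r-1}; the oscillation of q_n on this interval is
   controlled by the Dirichlet form, which equals a decrement of the convex sequence q_n(0) and so
   is at most q_n(0)/n. Hence p_t(0,0) <= 2/S(r) + 4r/t for every r.
   Lower bound: let F be convex with F(0) = 0 and L F <= 1. Then h = max(A - F, 0) loses at most 1/2 per lazy
   step, so T^n h(0) stays above h(0)/2 for n <= A, and Cauchy-Schwarz gives
   q_{2n}(0) >= 1/(4 V) with V the volume of {F < A}.

   The three volume estimates come from truncation and Chebyshev: S(n) >= c n ln n eventually,
   S(n) = O(n ln n) along n = 2^(m^2), and S(n) = O(n ln n (ln ln n)^2) eventually. The vanishing lower limit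
   is caused by single deep traps: for every C infinitely many sites n carry a trap deeper than
   C n ln n ln ln n, by the second Borel-Cantelli lemma. *)
theory Submission
  imports Defs "HOL-Real_Asymp.Real_Asymp"
begin

section \<open>The lazy chain\<close>

text \<open>At exponent one a trap has infinite mean depth: cut at level \<open>c\<close> it has
  mean \<open>ln c\<close> and second moment about \<open>c\<close>. A sum of \<open>n\<close> traps
  is therefore reliably of order at least \<open>n ln n\<close>, while from above one trap may
  outweigh all the others. This asymmetry shapes the proof. Upper heat kernel bounds use only the
  lower volume bound and hold at all large times; lower heat kernel bounds need volumes from above
  too, so they are had either at sparse scales, enough for the upper limit, or with a loss of
  iterated logarithms. The lazy chain is used because \<open>T\<close> is then positive
  semidefinite, which gives the convexity of q_n(0) and hence the bound on its decrements. As the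
  generator is bounded, \<open>exp (t L) = exp (- 2 t) exp (2 t T)\<close>, and everything can be
  done with series, without path space. The terms 1/S(r) and r/t balance at t = r S(r). If S(r) is
  of order r ln r, this gives r of order sqrt(t / ln t) and the value \<open>phi1 t\<close>. If one
  trap inflates S(r) by a factor C ln ln r, the same balance falls short of \<open>phi1 t\<close> by
  the factor sqrt(C ln ln t): this is the exponent 1/2 of the vanishing lower limit.\<close>

definition lazy_step :: "(int \<Rightarrow> real) \<Rightarrow> (int \<Rightarrow> real) \<Rightarrow> int \<Rightarrow> real" where
  "lazy_step e f x = f x + (f (x + 1) + f (x - 1) - 2 * f x) / (4 * e x)"

text \<open>The pairing of l^2(e), cut to a window. The operator identities are applied to functions
  that vanish near and beyond the ends of the window, so the finite sum is the full pairing and no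
  question of convergence arises.\<close>

definition inner_on :: "(int \<Rightarrow> real) \<Rightarrow> int \<Rightarrow> (int \<Rightarrow> real) \<Rightarrow> (int \<Rightarrow> real) \<Rightarrow> real" where
  "inner_on e N f g = (\<Sum>x\<in>{-N..N}. e x * f x * g x)"

lemma inner_on_diff_right:
  "inner_on e N f (\<lambda>x. g x - h x) = inner_on e N f g - inner_on e N f h"
  by (simp add: inner_on_def sum_subtractf algebra_simps)

lemma inner_on_diff_left:
  "inner_on e N (\<lambda>x. g x - h x) f = inner_on e N g f - inner_on e N h f"
  by (simp add: inner_on_def sum_subtractf algebra_simps)

lemma lazy_step_diff:
  "lazy_step e (\<lambda>x. f x - g x) = (\<lambda>x. lazy_step e f x - lazy_step e g x)"
  by (simp add: lazy_step_def fun_eq_iff diff_divide_distrib add_divide_distrib algebra_simps)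

text \<open>The two sums differ only in the terms at \<open>-N\<close> and \<open>N + 1\<close>,
  assumed to be 0. All summation by parts is reduced to this shift.\<close>

lemma sum_shift_int:
  fixes h :: "int \<Rightarrow> real"
  assumes "N \<ge> 0" "h (-N) = 0" "h (N + 1) = 0"
  shows "(\<Sum>x\<in>{-N..N}. h (x + 1)) = (\<Sum>x\<in>{-N..N}. h x)"
proof -
  have "(\<Sum>x\<in>{-N..N}. h (x + 1)) = (\<Sum>x\<in>{-N+1..N+1}. h x)"
    by (rule sum.reindex_bij_witness[of _ "\<lambda>x. x - 1" "\<lambda>x. x + 1"]) auto
  also have "\<dots> = (\<Sum>x\<in>{-N..N+1}. h x)"
  proof (rule sum.mono_neutral_left)
    show "\<forall>i\<in>{- N..N + 1} - {- N + 1..N + 1}. h i = 0"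
    proof
      fix i assume "i \<in> {- N..N + 1} - {- N + 1..N + 1}"
      then have "i = -N" by auto
      then show "h i = 0" using assms by simp
    qed
  qed (use assms in auto)
  also have "\<dots> = (\<Sum>x\<in>{-N..N}. h x)"
  proof (rule sum.mono_neutral_right)
    show "\<forall>i\<in>{- N..N + 1} - {- N..N}. h i = 0"
    proof
      fix i assume "i \<in> {- N..N + 1} - {- N..N}"
      then have "i = N + 1" by auto
      then show "h i = 0" using assms by simp
    qed
  qed auto
  finally show ?thesis .
qed

locale trap_environment =
  fixes e :: "int \<Rightarrow> real"
  assumes depth_ge_1: "e x \<ge> 1"
begin

lemma depth_pos: "e x > 0"
  using depth_ge_1[of x] by linarith

abbreviation T where "T \<equiv> lazy_step e"

text \<open>\<open>T\<close> is an average: the weight of \<open>x\<close> itself is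
  \<open>1 - 1 / (2 * e x)\<close>, nonnegative because depths are at least 1.\<close>

lemma lazy_step_mono:
  assumes "\<And>x. f x \<le> g x"
  shows "T f x \<le> T g x"
proof -
  have eq: "T h x = (1 - 1 / (2 * e x)) * h x + h (x + 1) / (4 * e x) + h (x - 1) / (4 * e x)" for h
    using depth_pos[of x] by (simp add: lazy_step_def field_simps)
  have "1 - 1 / (2 * e x) \<ge> 0" using depth_ge_1[of x] by (simp add: field_simps)
  then show ?thesis unfolding eq using assms depth_pos[of x]
    by (intro add_mono mult_left_mono divide_right_mono) auto
qed

lemma lazy_step_const: "T (\<lambda>_. c) = (\<lambda>_. c)"
  by (simp add: lazy_step_def fun_eq_iff)

lemma depth_lazy_step: "e x * T f x = e x * f x + (f (x + 1) + f (x - 1) - 2 * f x) / 4"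
  using depth_pos[of x] by (simp add: lazy_step_def field_simps)

text \<open>Reversibility: after multiplication by \<open>e x\<close> every jump has the symmetric
  weight \<open>1 / 4\<close>. The vanishing is asked of \<open>f\<close> alone, so that
  \<open>g\<close> can be a constant or any test function.\<close>

lemma inner_on_lazy_step:
  assumes N: "N \<ge> 0" and f: "\<And>x. \<bar>x\<bar> \<ge> N \<Longrightarrow> f x = 0"
  shows "inner_on e N (T f) g = inner_on e N f (T g)"
proof -
  have s1: "(\<Sum>x\<in>{-N..N}. f x * g (x + 1)) = (\<Sum>x\<in>{-N..N}. f (x - 1) * g x)"
    using sum_shift_int[of N "\<lambda>x. f (x - 1) * g x"] N f[of "-N-1"] f[of N] by simp
  have s2: "(\<Sum>x\<in>{-N..N}. f (x + 1) * g x) = (\<Sum>x\<in>{-N..N}. f x * g (x - 1))"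
    using sum_shift_int[of N "\<lambda>x. f x * g (x - 1)"] N f[of "-N"] f[of "N+1"] by simp
  have e1: "e x * T f x * g x = (e x * f x * g x - f x * g x / 2) + f (x + 1) * g x / 4 + f (x - 1) * g x / 4" for x
    unfolding depth_lazy_step by (simp add: field_simps)
  have e2: "e x * f x * T g x = (e x * f x * g x - f x * g x / 2) + f x * g (x + 1) / 4 + f x * g (x - 1) / 4" for x
  proof -
    have "e x * f x * T g x = f x * (e x * T g x)" by simp
    then show ?thesis unfolding depth_lazy_step by (simp add: field_simps)
  qed
  show ?thesis unfolding inner_on_def e1 e2 sum.distrib
    unfolding sum_divide_distrib[symmetric] s1 s2 by simp
qed

text \<open>Each edge has conductance \<open>1 / 4\<close>, whence the factor 4. As \<open>f\<close>
  is 0 at both ends, the window sees every edge along which \<open>f\<close> varies.\<close>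

lemma dirichlet_form:
  assumes N: "N \<ge> 0" and f: "\<And>x. \<bar>x\<bar> \<ge> N \<Longrightarrow> f x = 0"
  shows "4 * inner_on e N f (\<lambda>x. f x - T f x) = (\<Sum>x\<in>{-N..N}. (f (x + 1) - f x)\<^sup>2)"
proof -
  have s1: "(\<Sum>x\<in>{-N..N}. f x * f (x + 1)) = (\<Sum>x\<in>{-N..N}. f x * f (x - 1))"
    using sum_shift_int[of N "\<lambda>x. f (x - 1) * f x"] N f[of "-N-1"] f[of N] by (simp add: mult_ac)
  have s2: "(\<Sum>x\<in>{-N..N}. f (x + 1) * f (x + 1)) = (\<Sum>x\<in>{-N..N}. f x * f x)"
    using sum_shift_int[of N "\<lambda>x. f x * f x"] N f[of "-N"] f[of "N+1"] by simp
  have e1: "4 * (e x * f x * (f x - T f x)) = (f x * f x + f x * f x) - f x * f (x + 1) - f x * f (x - 1)" for x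
  proof -
    have "4 * (e x * f x * (f x - T f x)) = 4 * f x * (e x * f x - e x * T f x)"
      by (simp add: algebra_simps)
    then show ?thesis unfolding depth_lazy_step by (simp add: field_simps)
  qed
  have e2: "(f (x + 1) - f x)\<^sup>2 = (f (x + 1) * f (x + 1) + f x * f x) - f x * f (x + 1) - f x * f (x + 1)" for x
    by (simp add: power2_eq_square algebra_simps)
  show ?thesis unfolding inner_on_def sum_distrib_left e1 e2 sum.distrib sum_subtractf s1 s2 by simp
qed

lemma inner_on_self_nonneg: "inner_on e N f f \<ge> 0"
  unfolding inner_on_def using depth_pos
  by (intro sum_nonneg) (metis less_le mult.assoc mult_nonneg_nonneg zero_le_square)

text \<open>Positivity of \<open>T\<close>, where laziness enters: by
  \<open>(a - b)^2 \<le> 2 a^2 + 2 b^2\<close> the Dirichlet sum is at most four times the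
  unweighted square sum, and this is at most the weighted one because depths are at least 1.\<close>

lemma inner_on_lazy_step_nonneg:
  assumes N: "N \<ge> 0" and f: "\<And>x. \<bar>x\<bar> \<ge> N \<Longrightarrow> f x = 0"
  shows "inner_on e N f (T f) \<ge> 0"
proof -
  have s2: "(\<Sum>x\<in>{-N..N}. (f (x + 1))\<^sup>2) = (\<Sum>x\<in>{-N..N}. (f x)\<^sup>2)"
    using sum_shift_int[of N "\<lambda>x. (f x)\<^sup>2"] N f[of "-N"] f[of "N+1"] by simp
  have "(\<Sum>x\<in>{-N..N}. (f (x + 1) - f x)\<^sup>2) \<le> (\<Sum>x\<in>{-N..N}. 2 * (f (x + 1))\<^sup>2 + 2 * (f x)\<^sup>2)"
  proof (rule sum_mono)
    fix x
    have "0 \<le> (f (x + 1) + f x)\<^sup>2" by simp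
    then show "(f (x + 1) - f x)\<^sup>2 \<le> 2 * (f (x + 1))\<^sup>2 + 2 * (f x)\<^sup>2"
      by (simp add: power2_eq_square algebra_simps)
  qed
  also have "\<dots> = 4 * (\<Sum>x\<in>{-N..N}. (f x)\<^sup>2)"
    unfolding sum.distrib sum_distrib_left[symmetric] s2 by simp
  also have "\<dots> \<le> 4 * inner_on e N f f"
    unfolding inner_on_def
  proof (intro mult_left_mono sum_mono)
    fix x
    have "1 * (f x)\<^sup>2 \<le> e x * (f x)\<^sup>2" by (intro mult_right_mono depth_ge_1) auto
    then show "(f x)\<^sup>2 \<le> e x * f x * f x" by (simp add: power2_eq_square mult.assoc)
  qed auto
  finally show ?thesis using dirichlet_form[of N f] assms by (simp add: inner_on_diff_right)
qed

section \<open>Transition density of the lazy chain with respect to \<open>e\<close>, and the shape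
  of its values at the origin\<close>

definition kern :: "nat \<Rightarrow> int \<Rightarrow> real" where
  "kern n = (T ^^ n) (\<lambda>x. if x = 0 then 1 / e 0 else 0)"

lemma kern_0: "kern 0 = (\<lambda>x. if x = 0 then 1 / e 0 else 0)"
  by (simp add: kern_def)

lemma kern_Suc: "kern (Suc n) = T (kern n)"
  by (simp add: kern_def)

lemma kern_support: "\<bar>x\<bar> > int n \<Longrightarrow> kern n x = 0"
proof (induction n arbitrary: x)
  case (Suc n)
  then have "kern n x = 0" "kern n (x + 1) = 0" "kern n (x - 1) = 0"
    by (intro Suc.IH; linarith)+
  then show ?case by (simp add: kern_Suc lazy_step_def)
qed (simp add: kern_0)

lemma kern_nonneg: "kern n x \<ge> 0"
proof (induction n arbitrary: x)
  case 0
  show ?case using depth_pos[of 0] by (simp add: kern_0)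
next
  case (Suc n)
  have "T (\<lambda>_. 0) x \<le> T (kern n) x" by (intro lazy_step_mono Suc.IH)
  then show ?case by (simp add: kern_Suc lazy_step_const)
qed

text \<open>The initial value \<open>1 / e 0\<close> makes pairing with \<open>kern 0\<close> the
  evaluation at the origin; self-adjointness then moves each \<open>T\<close> to the test function.
  \<open>n < N\<close> keeps the supports inside the window.\<close>

lemma inner_on_kern:
  assumes "int n < N"
  shows "inner_on e N (kern n) h = (T ^^ n) h 0"
  using assms
proof (induction n arbitrary: h)
  case 0
  have "inner_on e N (kern 0) h = (\<Sum>x\<in>{-N..N}. if x = 0 then h 0 else 0)"
    unfolding inner_on_def kern_0 using depth_pos[of 0] by (intro sum.cong) auto
  then show ?case using 0 by simp
next
  case (Suc n)
  have "inner_on e N (kern (Suc n)) h = inner_on e N (kern n) (T h)"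
    unfolding kern_Suc using Suc.prems by (intro inner_on_lazy_step kern_support) auto
  also have "\<dots> = (T ^^ n) (T h) 0" using Suc by simp
  also have "\<dots> = (T ^^ Suc n) h 0" by (simp only: funpow_Suc_right comp_def)
  finally show ?case .
qed

text \<open>Chapman-Kolmogorov at the origin: the test function is itself a kernel. For
  \<open>m = n\<close> a square norm becomes an even return value.\<close>

lemma inner_on_kern_kern: "int m < N \<Longrightarrow> inner_on e N (kern m) (kern n) = kern (m + n) 0"
  by (simp add: inner_on_kern) (simp add: kern_def funpow_add)

lemma inner_on_kern_const: "int n < N \<Longrightarrow> inner_on e N (kern n) (\<lambda>_. c) = c"
proof -
  have "(T ^^ n) (\<lambda>_. c) = (\<lambda>_. c)" by (induction n) (auto simp: lazy_step_const)
  then show "int n < N \<Longrightarrow> inner_on e N (kern n) (\<lambda>_. c) = c" by (simp add: inner_on_kern)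
qed

lemma sum_kern_le:
  assumes "finite A"
  shows "(\<Sum>x\<in>A. e x * kern n x) \<le> 1"
proof -
  define N where "N = Max (insert (int n) (abs ` A)) + 1"
  have "\<bar>x\<bar> \<le> Max (insert (int n) (abs ` A))" if "x \<in> A" for x
    using that assms by (intro Max_ge) auto
  then have sub: "A \<subseteq> {-N..N}" unfolding N_def by force
  have "int n \<le> Max (insert (int n) (abs ` A))" using assms by (intro Max_ge) auto
  then have n: "int n < N" by (simp add: N_def)
  have "(\<Sum>x\<in>A. e x * kern n x) \<le> (\<Sum>x\<in>{-N..N}. e x * kern n x)"
    using sub depth_pos kern_nonneg by (intro sum_mono2) (auto intro!: mult_nonneg_nonneg intro: less_imp_le)
  also have "\<dots> = 1" using inner_on_kern_const[OF n, of 1] by (simp add: inner_on_def)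
  finally show ?thesis .
qed

lemma kern_le_1: "kern n x \<le> 1"
proof -
  have "1 * kern n x \<le> e x * kern n x" by (intro mult_right_mono depth_ge_1 kern_nonneg)
  also have "\<dots> \<le> 1" using sum_kern_le[of "{x}" n] by simp
  finally show ?thesis by simp
qed

text \<open>The link between decay in time and oscillation in space: pairing \<open>kern k\<close>
  with its own decrement is at once a difference of return values and the Dirichlet form.\<close>

lemma kern_even_decr: "kern (2 * k) 0 - kern (2 * k + 1) 0 =
    (\<Sum>x\<in>{-(int k + 1)..int k + 1}. (kern k (x + 1) - kern k x)\<^sup>2) / 4"
proof -
  let ?N = "int k + 1"
  have "4 * inner_on e ?N (kern k) (\<lambda>x. kern k x - T (kern k) x) =
    (\<Sum>x\<in>{-?N..?N}. (kern k (x + 1) - kern k x)\<^sup>2)"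
    by (rule dirichlet_form) (auto intro: kern_support)
  moreover have "inner_on e ?N (kern k) (\<lambda>x. kern k x - T (kern k) x) = kern (2 * k) 0 - kern (2 * k + 1) 0"
    unfolding inner_on_diff_right kern_Suc[symmetric] by (simp add: inner_on_kern_kern mult_2)
  ultimately show ?thesis by linarith
qed

lemma kern_convex: "kern (n + 1) 0 - kern (n + 2) 0 \<le> kern n 0 - kern (n + 1) 0"
proof -
  define j where "j = n div 2"
  define g where "g = (\<lambda>x. kern j x - kern (Suc j) x)"
  define N where "N = int j + 2"
  have g0: "\<And>x. \<bar>x\<bar> \<ge> N \<Longrightarrow> g x = 0" unfolding g_def N_def by (simp add: kern_support)
  have Tg: "T g = (\<lambda>x. kern (Suc j) x - kern (Suc (Suc j)) x)"
    unfolding g_def lazy_step_diff kern_Suc by simp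
  \<comment> \<open>The second difference is a square norm or a value of the positive semidefinite form of T.\<close>
  show ?thesis
  proof (cases "even n")
    case True
    then have n: "n = j + j" by (auto simp: j_def)
    have "inner_on e N g g = (kern n 0 - kern (n + 1) 0) - (kern (n + 1) 0 - kern (n + 2) 0)"
      unfolding g_def inner_on_diff_right inner_on_diff_left
      by (simp add: inner_on_kern_kern N_def n)
    then show ?thesis using inner_on_self_nonneg[of N g] by linarith
  next
    case False
    then have n: "n = Suc (j + j)" unfolding j_def by presburger
    have "inner_on e N g (T g) = (kern n 0 - kern (n + 1) 0) - (kern (n + 1) 0 - kern (n + 2) 0)"
      unfolding Tg unfolding g_def inner_on_diff_right inner_on_diff_left
      by (simp add: inner_on_kern_kern N_def n)
    moreover have "inner_on e N g (T g) \<ge> 0"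
      using g0 by (intro inner_on_lazy_step_nonneg) (auto simp: N_def)
    ultimately show ?thesis by linarith
  qed
qed

lemma kern_decr_antimono: "antimono (\<lambda>n. kern n 0 - kern (n + 1) 0)"
  using kern_convex by (intro decseq_SucI) simp

text \<open>Only the even decrements are sums of squares; convexity passes their sign on, since the
  decrement at \<open>n\<close> dominates the one at \<open>2 * n\<close>.\<close>

lemma kern_antimono: "antimono (\<lambda>n. kern n 0)"
proof (intro decseq_SucI)
  fix n
  have "0 \<le> kern (2 * n) 0 - kern (2 * n + 1) 0"
    unfolding kern_even_decr by (auto intro!: sum_nonneg)
  also have "\<dots> \<le> kern n 0 - kern (n + 1) 0"
    using antimonoD[OF kern_decr_antimono, of n "2 * n"] by simp
  finally show "kern (Suc n) 0 \<le> kern n 0" by simp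
qed

text \<open>By convexity the decrement at \<open>2 * n\<close> is at most each of the
  \<open>n\<close> decrements before it, and these telescope to at most
  \<open>kern n 0\<close>.\<close>

lemma kern_decr_le: "real n * (kern (2 * n) 0 - kern (2 * n + 1) 0) \<le> kern n 0"
proof -
  have "real n * (kern (2 * n) 0 - kern (2 * n + 1) 0) = (\<Sum>k\<in>{n..<2*n}. kern (2 * n) 0 - kern (2 * n + 1) 0)"
    by simp
  also have "\<dots> \<le> (\<Sum>k\<in>{n..<2*n}. kern k 0 - kern (k + 1) 0)"
    by (intro sum_mono) (use antimonoD[OF kern_decr_antimono] in auto)
  also have "\<dots> = kern n 0 - kern (2 * n) 0"
    using sum_Suc_diff'[of n "2 * n" "\<lambda>k. - kern k 0"] by simp
  also have "\<dots> \<le> kern n 0" using kern_nonneg[of "2 * n" 0] by simp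
  finally show ?thesis .
qed

end

section \<open>Bounds for the return values of the lazy chain in terms of volumes\<close>

lemma telescope_power2_le:
  fixes f :: "nat \<Rightarrow> real"
  shows "(f 0 - f m)\<^sup>2 \<le> real m * (\<Sum>i<m. (f (Suc i) - f i)\<^sup>2)"
proof -
  have "f m - f 0 = (\<Sum>i<m. 1 * (f (Suc i) - f i))" by (simp add: sum_lessThan_telescope)
  then have "(f m - f 0)\<^sup>2 \<le> (\<Sum>i<m. 1\<^sup>2) * (\<Sum>i<m. (f (Suc i) - f i)\<^sup>2)"
    using Cauchy_Schwarz_ineq_sum[of "\<lambda>_. 1" "\<lambda>i. f (Suc i) - f i" "{..<m}"] by simp
  then show ?thesis by (simp add: power2_commute)
qed

text \<open>Pascal's rule. With \<open>y = -2\<close> and \<open>b k\<close> equal to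
  \<open>2 ^ k\<close> times the \<open>k\<close>-th kernel, it is the induction step for the powers
  of \<open>L = 2 T - 2\<close>.\<close>

lemma binomial_sum_Suc:
  fixes y :: real
  shows "(\<Sum>k\<le>n. real (n choose k) * y ^ (n - k) * b (Suc k)) + y * (\<Sum>k\<le>n. real (n choose k) * y ^ (n - k) * b k)
    = (\<Sum>k\<le>Suc n. real (Suc n choose k) * y ^ (Suc n - k) * b k)"
proof -
  have "y * (\<Sum>k\<le>n. real (n choose k) * y ^ (n - k) * b k) = (\<Sum>k\<le>n. real (n choose k) * y ^ (Suc n - k) * b k)"
    unfolding sum_distrib_left by (intro sum.cong) (auto simp: Suc_diff_le)
  also have "\<dots> = (\<Sum>k\<le>Suc n. real (n choose k) * y ^ (Suc n - k) * b k)" by simp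
  also have "\<dots> = y ^ Suc n * b 0 + (\<Sum>k\<le>n. real (n choose Suc k) * y ^ (n - k) * b (Suc k))"
    by (subst sum.atMost_Suc_shift) simp
  finally have "y * (\<Sum>k\<le>n. real (n choose k) * y ^ (n - k) * b k) = \<dots>" .
  then show ?thesis
    by (subst sum.atMost_Suc_shift) (simp add: sum.distrib algebra_simps)
qed

lemma four_mult_le_power2_add: "4 * u * v \<le> (u + v)\<^sup>2" for u v :: real
  using zero_le_power2[of "u - v"] by (simp add: power2_eq_square algebra_simps)

context trap_environment
begin

text \<open>With \<open>a\<close> the value at the origin and \<open>b\<close> a value at most
  \<open>1 / V\<close> nearby, the oscillation estimate reads
  \<open>(a - b)^2 \<le> 4 r a / n\<close>. Its right side contains \<open>a\<close> again; the
  inequality of the two means splits off \<open>a / 2\<close>, which is absorbed. The denominator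
  \<open>n + 1\<close> includes \<open>n = 0\<close> and suits the later average over a Poisson
  variable.\<close>

lemma kern_upper:
  assumes r: "r \<ge> 1"
  shows "kern n 0 \<le> 2 / (\<Sum>i<r. e (int i)) + 8 * real r / (real n + 1)"
proof (cases "n = 0")
  case True
  have "kern n 0 \<le> 1" by (rule kern_le_1)
  also have "\<dots> \<le> 8 * real r / (real n + 1)" using r True by simp
  finally have "kern n 0 \<le> 8 * real r / (real n + 1)" .
  moreover have "0 \<le> 2 / (\<Sum>i<r. e (int i))" using depth_pos by (auto intro!: sum_nonneg intro: less_imp_le)
  ultimately show ?thesis by linarith
next
  case False
  define V where "V = (\<Sum>i<r. e (int i))"
  have V: "V > 0" unfolding V_def using r depth_pos by (intro sum_pos) (auto simp: lessThan_empty_iff)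
  \<comment> \<open>Pigeonhole: a kernel above \<open>1 / V\<close> on all \<open>r\<close> sites
    would have mass above 1 there.\<close>
  have "\<exists>i<r. kern n (int i) \<le> 1 / V"
  proof (rule ccontr)
    assume "\<not> ?thesis"
    then have "\<And>i. i < r \<Longrightarrow> 1 / V < kern n (int i)" by auto
    then have "(\<Sum>i<r. e (int i) * (1 / V)) < (\<Sum>i<r. e (int i) * kern n (int i))"
      using r depth_pos
      by (intro sum_strict_mono mult_strict_left_mono) (auto simp: lessThan_empty_iff)
    also have "\<dots> = (\<Sum>x\<in>int ` {..<r}. e x * kern n x)" by (subst sum.reindex) auto
    also have "\<dots> \<le> 1" by (rule sum_kern_le) simp
    also have "(\<Sum>i<r. e (int i) * (1 / V)) = 1"
      using V unfolding sum_distrib_right[symmetric] V_def[symmetric] by simp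
    finally show False by simp
  qed
  then obtain m where m: "m < r" "kern n (int m) \<le> 1 / V" by auto
  define a where "a = kern n 0"
  define b where "b = kern n (int m)"
  have a0: "a \<ge> 0" unfolding a_def by (rule kern_nonneg)
  let ?d = "\<lambda>x. (kern n (x + 1) - kern n x)\<^sup>2"
  have "(\<Sum>i<m. (kern n (int (Suc i)) - kern n (int i))\<^sup>2) = (\<Sum>x\<in>int ` {..<m}. ?d x)"
    by (subst sum.reindex) (auto simp: add.commute)
  \<comment> \<open>The path to \<open>m\<close> may run past the window of the Dirichlet sum, but
    the kernel is 0 out there.\<close>
  also have "\<dots> = (\<Sum>x\<in>int ` {..<m} \<inter> {-(int n + 1)..int n + 1}. ?d x)"
  proof (rule sum.mono_neutral_right)
    show "\<forall>x\<in>int ` {..<m} - int ` {..<m} \<inter> {-(int n + 1)..int n + 1}. ?d x = 0"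
    proof
      fix x assume "x \<in> int ` {..<m} - int ` {..<m} \<inter> {-(int n + 1)..int n + 1}"
      then have "\<bar>x\<bar> > int n" "\<bar>x + 1\<bar> > int n" by auto
      then show "?d x = 0" by (simp add: kern_support)
    qed
  qed auto
  also have "\<dots> \<le> (\<Sum>x\<in>{-(int n + 1)..int n + 1}. ?d x)"
    by (rule sum_mono2) auto
  also have "\<dots> = 4 * (kern (2 * n) 0 - kern (2 * n + 1) 0)"
    unfolding kern_even_decr by simp
  also have "\<dots> \<le> 4 * (a / n)"
    using kern_decr_le[of n] False by (simp add: a_def field_simps)
  finally have "(a - b)\<^sup>2 \<le> real m * (4 * (a / n))"
    using telescope_power2_le[of "\<lambda>i. kern n (int i)" m] unfolding a_def b_def
    by (smt (verit) mult_left_mono of_nat_0_le_iff of_nat_0)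
  also have "\<dots> \<le> real r * (4 * (a / n))"
    using m a0 by (intro mult_right_mono) auto
  also have "\<dots> = 4 * (a / 2) * (2 * real r / n)" by simp
  also have "\<dots> \<le> (a / 2 + 2 * real r / n)\<^sup>2"
    by (rule four_mult_le_power2_add)
  finally have "a - b \<le> a / 2 + 2 * real r / n"
    by (rule power2_le_imp_le) (use a0 in auto)
  then have "a \<le> 2 * b + 4 * real r / n" by simp
  also have "4 * real r / n = 8 * real r / (2 * real n)" using False by simp
  also have "\<dots> \<le> 8 * real r / (real n + 1)"
    using False by (intro divide_left_mono) auto
  finally have "a \<le> 2 * (1 / V) + 8 * real r / (real n + 1)"
    using m(2) unfolding b_def[symmetric] by simp
  then show ?thesis unfolding a_def V_def by simp
qed

text \<open>The bound on second differences says \<open>L F \<le> 1\<close>. Cutting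
  \<open>A - F\<close> at 0 confines \<open>h\<close> to the window, so its square norm is at most
  the volume times \<open>A^2\<close>, while at least half of \<open>h 0 = A\<close> survives
  \<open>n\<close> steps. Cauchy-Schwarz compares the two, \<open>A^2\<close> cancels and only the
  volume is left.\<close>

lemma kern_lower:
  assumes sub: "\<And>x. F (x + 1) + F (x - 1) - 2 * F x \<le> 2 * e x" and F0: "F 0 = 0"
    and out: "\<And>x. \<bar>x\<bar> > N \<Longrightarrow> F x \<ge> A" and Fnn: "\<And>x. F x \<ge> 0"
    and A: "A > 0" and N: "N \<ge> 0" and n: "real n \<le> A"
  shows "kern n 0 \<ge> 1 / (4 * (\<Sum>x\<in>{-N..N}. e x))"
proof -
  define h where "h = (\<lambda>x. max (A - F x) 0)"
  have step: "h x - 1 / 2 \<le> T h x" for x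
  proof (cases "F x \<le> A")
    case True
    \<comment> \<open>At \<open>x\<close> the cut is inactive, and at the neighbours it can only
      raise \<open>h\<close>.\<close>
    have "A - F (x + 1) + (A - F (x - 1)) - 2 * (A - F x) \<le> h (x + 1) + h (x - 1) - 2 * h x"
      using True unfolding h_def by simp
    then have "- (2 * e x) \<le> h (x + 1) + h (x - 1) - 2 * h x" using sub[of x] by argo
    then have "- (1 / 2) \<le> (h (x + 1) + h (x - 1) - 2 * h x) / (4 * e x)"
      using depth_pos[of x] by (simp add: field_simps)
    then show ?thesis by (simp add: lazy_step_def)
  next
    case False
    then have "h x = 0" by (simp add: h_def)
    moreover have "T (\<lambda>_. 0) x \<le> T h x" by (intro lazy_step_mono) (simp add: h_def)
    ultimately show ?thesis by (simp add: lazy_step_const)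
  qed
  have iter: "h x - real n / 2 \<le> (T ^^ n) h x" for x
  proof (induction n arbitrary: x)
    case (Suc n)
    have "h x - real (Suc n) / 2 \<le> T h x - real n / 2" using step[of x] by (simp add: add_divide_distrib)
    also have "\<dots> = T (\<lambda>x. h x - real n / 2) x"
      using lazy_step_diff[of e h "\<lambda>_. real n / 2"] by (simp add: lazy_step_const)
    also have "\<dots> \<le> T ((T ^^ n) h) x" by (intro lazy_step_mono Suc.IH)
    finally show ?case by simp
  qed simp
  define K where "K = max N (int n + 1)"
  define V where "V = (\<Sum>x\<in>{-N..N}. e x)"
  have V: "V > 0" unfolding V_def using N depth_pos by (intro sum_pos) auto
  have hA: "h x \<le> A" for x using Fnn[of x] A by (simp add: h_def)
  have h0: "h x = 0" if "\<bar>x\<bar> > N" for x using out[OF that] by (simp add: h_def)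
  have "A / 2 \<le> (T ^^ n) h 0" using iter[of 0] n F0 A by (simp add: h_def)
  also have "\<dots> = inner_on e K (kern n) h" by (rule inner_on_kern[symmetric]) (simp add: K_def)
  finally have low: "A / 2 \<le> inner_on e K (kern n) h" .
  \<comment> \<open>The weight is shared evenly between the factors, so that the plain
    Cauchy-Schwarz inequality gives the one of l^2(e).\<close>
  have "inner_on e K (kern n) h = (\<Sum>x\<in>{-K..K}. (sqrt (e x) * kern n x) * (sqrt (e x) * h x))"
    unfolding inner_on_def
  proof (rule sum.cong)
    fix x
    have "sqrt (e x) * sqrt (e x) = e x" using depth_pos[of x] by simp
    then show "e x * kern n x * h x = (sqrt (e x) * kern n x) * (sqrt (e x) * h x)"
      by (metis mult.assoc mult.left_commute)
  qed simp
  then have "(inner_on e K (kern n) h)\<^sup>2 \<le> (\<Sum>x\<in>{-K..K}. (sqrt (e x) * kern n x)\<^sup>2) * (\<Sum>x\<in>{-K..K}. (sqrt (e x) * h x)\<^sup>2)"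
    using Cauchy_Schwarz_ineq_sum by metis
  also have "(\<Sum>x\<in>{-K..K}. (sqrt (e x) * kern n x)\<^sup>2) = inner_on e K (kern n) (kern n)"
    unfolding inner_on_def using depth_pos
    by (intro sum.cong) (auto simp: power_mult_distrib power2_eq_square less_imp_le)
  also have "\<dots> = kern (2 * n) 0" by (subst inner_on_kern_kern) (auto simp: K_def mult_2)
  also have "(\<Sum>x\<in>{-K..K}. (sqrt (e x) * h x)\<^sup>2) = (\<Sum>x\<in>{-N..N}. (sqrt (e x) * h x)\<^sup>2)"
    by (rule sum.mono_neutral_right) (auto simp: K_def h0)
  also have "\<dots> \<le> (\<Sum>x\<in>{-N..N}. e x * A\<^sup>2)"
  proof (rule sum_mono)
    fix x
    show "(sqrt (e x) * h x)\<^sup>2 \<le> e x * A\<^sup>2"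
      using depth_pos[of x] hA[of x] by (auto simp: power_mult_distrib h_def intro!: mult_left_mono power_mono)
  qed
  also have "\<dots> = V * A\<^sup>2" by (simp add: V_def sum_distrib_right)
  finally have "(inner_on e K (kern n) h)\<^sup>2 \<le> kern (2 * n) 0 * (V * A\<^sup>2)"
    using kern_nonneg by (simp add: mult_left_mono)
  moreover have "(A / 2)\<^sup>2 \<le> (inner_on e K (kern n) h)\<^sup>2" using low A by (intro power_mono) auto
  ultimately have "A\<^sup>2 * 1 \<le> A\<^sup>2 * (kern (2 * n) 0 * V * 4)" by (simp add: power_divide mult_ac)
  then have "1 \<le> kern (2 * n) 0 * V * 4" using A by simp
  then have "1 / (4 * V) \<le> kern (2 * n) 0" using V by (simp add: field_simps)
  also have "\<dots> \<le> kern n 0" using antimonoD[OF kern_antimono, of n "2 * n"] by simp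
  finally show ?thesis by (simp add: V_def)
qed

section \<open>Continuous time: the generator as \<open>2 T - 2\<close>, and Poisson mixing\<close>

lemma trap_gen_pow_Suc:
  "trap_gen_pow e (Suc n) x y = 2 * (T (\<lambda>z. trap_gen_pow e n z y) x - trap_gen_pow e n x y)"
proof -
  have "{x - 1..x + 1} = {x - 1, x, x + 1}" by auto
  then show ?thesis using depth_pos[of x] by (simp add: trap_gen_def lazy_step_def field_simps)
qed

lemma lazy_step_sum: "T (\<lambda>x. \<Sum>k\<in>A. c k * f k x) x = (\<Sum>k\<in>A. c k * T (f k) x)"
proof (induction A rule: infinite_finite_induct)
  case (insert a A)
  then show ?case by (simp add: lazy_step_def add_divide_distrib diff_divide_distrib algebra_simps)
qed (auto simp: lazy_step_def)

text \<open>The binomial theorem for \<open>2 T - 2\<close>, applied to the indicator of the origin,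
  which is \<open>e 0 * kern 0\<close>.\<close>

lemma trap_gen_pow_kern:
  "trap_gen_pow e n x 0 = (\<Sum>k\<le>n. e 0 * real (n choose k) * (-2) ^ (n - k) * 2 ^ k * kern k x)"
proof (induction n arbitrary: x)
  case 0
  show ?case using depth_pos[of 0] by (simp add: kern_0)
next
  case (Suc n)
  have "trap_gen_pow e (Suc n) x 0 =
      2 * (\<Sum>k\<le>n. e 0 * real (n choose k) * (-2) ^ (n - k) * 2 ^ k * kern (Suc k) x)
      + (-2) * (\<Sum>k\<le>n. e 0 * real (n choose k) * (-2) ^ (n - k) * 2 ^ k * kern k x)"
    unfolding trap_gen_pow_Suc Suc.IH lazy_step_sum kern_Suc by simp
  also have "\<dots> = e 0 * ((\<Sum>k\<le>n. real (n choose k) * (-2) ^ (n - k) * (2 ^ Suc k * kern (Suc k) x))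
      + (-2) * (\<Sum>k\<le>n. real (n choose k) * (-2) ^ (n - k) * (2 ^ k * kern k x)))"
    unfolding sum_distrib_left distrib_left by (simp add: mult_ac)
  also have "\<dots> = e 0 * (\<Sum>k\<le>Suc n. real (Suc n choose k) * (-2) ^ (Suc n - k) * (2 ^ k * kern k x))"
    by (simp only: binomial_sum_Suc[of n "-2" "\<lambda>k. 2 ^ k * kern k x"])
  finally show ?case by (simp only: sum_distrib_left mult_ac)
qed

lemma summable_kern_series: "summable (\<lambda>n. \<bar>t ^ n / fact n * kern n 0\<bar>)"
proof (rule summable_comparison_test)
  show "summable (\<lambda>n. \<bar>t\<bar> ^ n / fact n)"
    using summable_exp[of "\<bar>t\<bar>"] by (simp add: field_simps)
  have "\<bar>t ^ n / fact n * kern n 0\<bar> \<le> \<bar>t\<bar> ^ n / fact n" for n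
    using kern_nonneg[of n 0] kern_le_1[of n 0]
    by (simp add: abs_mult power_abs mult_left_le divide_right_mono)
  then show "\<exists>N. \<forall>n\<ge>N. norm \<bar>t ^ n / fact n * kern n 0\<bar> \<le> \<bar>t\<bar> ^ n / fact n" by auto
qed

text \<open>\<open>exp (t L) = exp (2 t T) exp (- 2 t)\<close> at the level of series: the binomial
  expansion makes the exponential series a Cauchy product. The factor \<open>e 0\<close> cancels
  against the normalisation of the heat kernel.\<close>

lemma heat_kernel_eq_poisson_mixture:
  "trap_heat_kernel e t 0 0 = exp (-2 * t) * (\<Sum>n. (2 * t) ^ n / fact n * kern n 0)"
proof -
  let ?a = "\<lambda>n. (2 * t) ^ n / fact n * kern n 0" and ?b = "\<lambda>n. (-2 * t) ^ n / fact n"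
  have eq: "t ^ n / fact n * trap_gen_pow e n 0 0 = e 0 * (\<Sum>k\<le>n. ?a k * ?b (n - k))" for n
  proof -
    have "t ^ n / fact n * (e 0 * real (n choose k) * (-2) ^ (n - k) * 2 ^ k * kern k 0) = e 0 * (?a k * ?b (n - k))"
      if "k \<le> n" for k
    proof -
      have "t ^ n = t ^ k * t ^ (n - k)" using that by (simp flip: power_add)
      then show ?thesis using binomial_fact[OF that, where ?'a=real] by (simp add: power_mult_distrib power_minus' mult_ac)
    qed
    then show ?thesis unfolding trap_gen_pow_kern sum_distrib_left by (intro sum.cong) auto
  qed
  have b: "summable (\<lambda>n. norm (?b n))"
    using summable_norm_exp[of "-2 * t"] by (simp add: field_simps)
  have expb: "(\<Sum>n. ?b n) = exp (-2 * t)" by (simp add: exp_def field_simps)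
  have "(\<lambda>n. \<Sum>k\<le>n. ?a k * ?b (n - k)) sums ((\<Sum>n. ?a n) * (\<Sum>n. ?b n))"
    using summable_kern_series[of "2 * t"] b by (intro Cauchy_product_sums) (auto simp only: real_norm_def)
  then have "(\<lambda>n. e 0 * (\<Sum>k\<le>n. ?a k * ?b (n - k))) sums (e 0 * ((\<Sum>n. ?a n) * exp (-2 * t)))"
    unfolding expb by (rule sums_mult)
  then have "trap_trans e t 0 0 = e 0 * ((\<Sum>n. ?a n) * exp (-2 * t))"
    unfolding trap_trans_def eq by (rule sums_unique[symmetric])
  then show ?thesis unfolding trap_heat_kernel_def using depth_pos[of 0] by (simp add: mult_ac)
qed

lemma heat_kernel_nonneg: "t \<ge> 0 \<Longrightarrow> trap_heat_kernel e t 0 0 \<ge> 0"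
  unfolding heat_kernel_eq_poisson_mixture 
  by (intro mult_nonneg_nonneg suminf_nonneg summable_rabs_cancel[OF summable_kern_series])
    (auto simp: kern_nonneg)

lemma heat_kernel_upper:
  assumes r: "r \<ge> 1" and t: "t > 0"
  shows "trap_heat_kernel e t 0 0 \<le> 2 / (\<Sum>i<r. e (int i)) + 4 * real r / t"
proof -
  define V where "V = (\<Sum>i<r. e (int i))"
  define s where "s = 2 * t"
  have s: "s > 0" using t by (simp add: s_def)
  have e1: "(\<lambda>n. s ^ n / fact n) sums exp s"
    using exp_converges[of s] by (simp add: field_simps)
  have "(\<lambda>n. s ^ Suc n / fact (Suc n)) sums (exp s - 1)"
    using e1 by (subst sums_Suc_iff) simp
  then have e2: "(\<lambda>n. inverse s * (s ^ Suc n / fact (Suc n))) sums (inverse s * (exp s - 1))"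
    by (rule sums_mult)
  \<comment> \<open>For N Poisson with mean s, the expectation of 1/(N + 1) is at most 1/s.\<close>
  have eq2: "inverse s * (s ^ Suc n / fact (Suc n)) = s ^ n / fact n / (real n + 1)" for n
    using s by (simp add: field_simps)
  have bnd: "(\<lambda>n. 2 / V * (s ^ n / fact n) + 8 * real r * (s ^ n / fact n / (real n + 1))) sums
    (2 / V * exp s + 8 * real r * (inverse s * (exp s - 1)))"
    using e1 e2 unfolding eq2 by (intro sums_add sums_mult)
  have "(\<Sum>n. s ^ n / fact n * kern n 0) \<le> 2 / V * exp s + 8 * real r * (inverse s * (exp s - 1))"
  proof (rule suminf_le[THEN order_trans])
    show "summable (\<lambda>n. s ^ n / fact n * kern n 0)" by (rule summable_rabs_cancel[OF summable_kern_series])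
    fix n
    have "s ^ n / fact n * kern n 0 \<le> s ^ n / fact n * (2 / V + 8 * real r / (real n + 1))"
      using s kern_upper[OF r] by (intro mult_left_mono) (auto simp: V_def)
    then show "s ^ n / fact n * kern n 0 \<le> 2 / V * (s ^ n / fact n) + 8 * real r * (s ^ n / fact n / (real n + 1))"
      by (simp add: distrib_left mult_ac)
  qed (use bnd in \<open>auto simp: sums_iff\<close>)
  also have "\<dots> \<le> 2 / V * exp s + 8 * real r * (inverse s * exp s)"
    using s by (intro add_left_mono mult_left_mono) auto
  also have "\<dots> = (2 / V + 4 * real r / t) * exp s" using t by (simp add: s_def field_simps)
  finally have "exp (-s) * (\<Sum>n. s ^ n / fact n * kern n 0) \<le> exp (-s) * ((2 / V + 4 * real r / t) * exp s)"
    by (intro mult_left_mono) auto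
  also have "\<dots> = 2 / V + 4 * real r / t" by (simp add: exp_minus field_simps)
  finally show ?thesis unfolding heat_kernel_eq_poisson_mixture V_def s_def by simp
qed

text \<open>Markov's inequality: a Poisson variable of mean \<open>s = 2 * t\<close> is at most
  \<open>2 * s = 4 * t\<close> with probability at least 1/2. In the series, the indicator of
  \<open>n \<le> 2 * s\<close> is replaced by the smaller linear function
  \<open>1 - n / (2 * s)\<close>, whose mean is exactly 1/2.\<close>

lemma heat_kernel_ge_half_of_kern_ge:
  assumes c: "c \<ge> 0" and k: "\<And>n. real n \<le> 4 * t \<Longrightarrow> kern n 0 \<ge> c" and t: "t > 0"
  shows "trap_heat_kernel e t 0 0 \<ge> c / 2"
proof -
  define s where "s = 2 * t"
  have s: "s > 0" using t by (simp add: s_def)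
  have e1: "(\<lambda>n. s ^ n / fact n) sums exp s"
    using exp_converges[of s] by (simp add: field_simps)
  have eq2: "s * (s ^ n / fact n) = s ^ Suc n / fact (Suc n) * real (Suc n)" for n
    by (simp add: field_simps del: of_nat_Suc)
  have "(\<lambda>n. s * (s ^ n / fact n)) sums (s * exp s)" using e1 by (rule sums_mult)
  then have e2: "(\<lambda>n. s ^ n / fact n * real n) sums (s * exp s)"
    unfolding eq2 using sums_Suc_iff[of "\<lambda>n. s ^ n / fact n * real n" "s * exp s"] by simp
  have bnd: "(\<lambda>n. c * (s ^ n / fact n) - c / (2 * s) * (s ^ n / fact n * real n)) sums
    (c * exp s - c / (2 * s) * (s * exp s))"
    using e1 e2 by (intro sums_diff sums_mult)
  have "c / 2 * exp s = c * exp s - c / (2 * s) * (s * exp s)" using s by (simp add: field_simps)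
  also have "\<dots> = (\<Sum>n. c * (s ^ n / fact n) - c / (2 * s) * (s ^ n / fact n * real n))"
    using bnd by (rule sums_unique)
  also have "\<dots> \<le> (\<Sum>n. s ^ n / fact n * kern n 0)"
  proof (rule suminf_le)
    show "summable (\<lambda>n. s ^ n / fact n * kern n 0)" by (rule summable_rabs_cancel[OF summable_kern_series])
    show "summable (\<lambda>n. c * (s ^ n / fact n) - c / (2 * s) * (s ^ n / fact n * real n))"
      using bnd by (simp add: sums_iff)
    fix n
    have "c - c / (2 * s) * real n \<le> kern n 0"
    proof (cases "real n \<le> 2 * s")
      case True
      then have "c \<le> kern n 0" by (intro k) (simp add: s_def)
      moreover have "c / (2 * s) * real n \<ge> 0" using c s by simp
      ultimately show ?thesis by linarith
    next
      case False
      then have "c * (2 * s) \<le> c * real n" using c by (intro mult_left_mono) auto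
      then have "c - c / (2 * s) * real n \<le> 0" using s by (simp add: field_simps)
      also have "\<dots> \<le> kern n 0" by (rule kern_nonneg)
      finally show ?thesis .
    qed
    then have "s ^ n / fact n * (c - c / (2 * s) * real n) \<le> s ^ n / fact n * kern n 0"
      using s by (intro mult_left_mono) auto
    then show "c * (s ^ n / fact n) - c / (2 * s) * (s ^ n / fact n * real n) \<le> s ^ n / fact n * kern n 0"
      by (simp add: algebra_simps)
  qed
  finally have "exp (-s) * (c / 2 * exp s) \<le> exp (-s) * (\<Sum>n. s ^ n / fact n * kern n 0)"
    by (intro mult_left_mono) auto
  then show ?thesis unfolding heat_kernel_eq_poisson_mixture s_def by (simp add: exp_minus field_simps)
qed

text \<open>\<open>k\<close> times the volume of \<open>k\<close> sites is the time scale for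
  leaving an interval of length \<open>k\<close>. Both sides are asked to reach
  \<open>4 * t\<close>, which serves as the height \<open>A\<close> of the test function and as the
  number of steps to be covered under Poisson mixing.\<close>

lemma heat_kernel_lower:
  assumes k: "k \<ge> 1" and t: "t > 0"
    and right: "4 * t \<le> real k * (\<Sum>i<k. e (int i))"
    and left: "4 * t \<le> real k * (\<Sum>i<k. e (- int i))"
  shows "trap_heat_kernel e t 0 0 \<ge> 1 / (8 * ((\<Sum>i<2*k. e (int i)) + (\<Sum>i<2*k. e (- int i))))"
proof -
  define S where "S = (\<lambda>(g :: nat \<Rightarrow> real) m. \<Sum>i<m. g i)"
  \<comment> \<open>On each side of the origin the second difference of F at x is e x, and 2 e 0 at the origin.\<close>
  define W where "W = (\<lambda>g m. \<Sum>j<m. S g (Suc j))"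
  define er el where "er = (\<lambda>i. e (int i))" and "el = (\<lambda>i. e (- int i))"
  define F where "F = (\<lambda>x. if x \<ge> 0 then W er (nat x) else W el (nat (- x)))"
  have pos: "er i > 0" "el i > 0" for i using depth_pos by (auto simp: er_def el_def)
  have Wdiff: "W g (Suc (Suc m)) + W g m - 2 * W g (Suc m) = g (Suc m)" for g m
    by (simp add: W_def S_def)
  have Wmono: "W g m \<le> W g n" if "m \<le> n" "\<And>i. g i > 0" for g m n
    unfolding W_def S_def using that
    by (intro sum_mono2) (auto intro!: sum_nonneg add_nonneg_nonneg intro: less_imp_le)
  \<comment> \<open>The inner sums increase, so the last \<open>k\<close> of the
    \<open>2 * k\<close> terms are each at least \<open>S g k\<close>. Hence \<open>k\<close> sites
    in the hypotheses and \<open>2 * k\<close> in the volume.\<close>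
  have W2: "real k * S g k \<le> W g (2 * k)" if g: "\<And>i. g i > 0" for g
  proof -
    have "real k * S g k = (\<Sum>j\<in>{k..<2*k}. S g k)" by simp
    also have "\<dots> \<le> (\<Sum>j\<in>{k..<2*k}. S g (Suc j))"
      unfolding S_def using g by (intro sum_mono sum_mono2) (auto intro: less_imp_le)
    also have "\<dots> \<le> W g (2 * k)"
      unfolding W_def S_def using g
      by (intro sum_mono2) (auto intro!: sum_nonneg add_nonneg_nonneg intro: less_imp_le)
    finally show ?thesis .
  qed
  have W0: "W g 0 = 0" for g by (simp add: W_def)
  have Fsub: "F (x + 1) + F (x - 1) - 2 * F x \<le> 2 * e x" for x
  proof -
    consider "x = 0" | m where "x = int (Suc m)" | m where "x = - int (Suc m)"
      by (metis int_cases2 nat.exhaust of_nat_0 neg_equal_0_iff_equal)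
    then show ?thesis
    proof cases
      case 1
      then show ?thesis by (simp add: F_def W_def S_def er_def el_def)
    next
      case 2
      then have "F (x + 1) = W er (Suc (Suc m))" "F (x - 1) = W er m" "F x = W er (Suc m)"
        by (auto simp: F_def nat_add_distrib)
      then show ?thesis using Wdiff[of er m] pos(1)[of "Suc m"] 2 by (simp add: er_def)
    next
      case 3
      have "F (x + 1) = W el m"
        by (cases m) (auto simp: F_def 3 W0 nat_add_distrib)
      moreover have "F (x - 1) = W el (Suc (Suc m))" "F x = W el (Suc m)"
        by (auto simp: F_def 3 nat_add_distrib)
      ultimately show ?thesis using Wdiff[of el m] pos(2)[of "Suc m"] 3 by (simp add: el_def)
    qed
  qed
  \<comment> \<open>Sites beyond this \<open>N\<close> are at distance at least
    \<open>2 * k\<close>, where \<open>W2\<close> applies; the window is the union of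
    \<open>2 * k\<close> sites on either side, both including the origin.\<close>
  define N where "N = 2 * int k - 1"
  have out: "F x \<ge> 4 * t" if "\<bar>x\<bar> > N" for x
  proof (cases "x \<ge> 0")
    case True
    then have "W er (2 * k) \<le> W er (nat x)" using that pos by (intro Wmono) (auto simp: N_def)
    then show ?thesis using W2[of er] pos right True by (simp add: F_def er_def S_def)
  next
    case False
    then have "W el (2 * k) \<le> W el (nat (-x))" using that pos by (intro Wmono) (auto simp: N_def)
    then show ?thesis using W2[of el] pos left False by (simp add: F_def el_def S_def)
  qed
  have Fnn: "F x \<ge> 0" for x
    unfolding F_def using Wmono[of 0 _ er] Wmono[of 0 _ el] pos by (auto simp: W0)
  have kl: "kern n 0 \<ge> 1 / (4 * (\<Sum>x\<in>{-N..N}. e x))" if "real n \<le> 4 * t" for n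
    by (rule kern_lower[OF Fsub _ out Fnn]) (use that t k in \<open>auto simp: F_def W0 N_def\<close>)
  define V where "V = (\<Sum>x\<in>{-N..N}. e x)"
  have V: "V > 0" unfolding V_def using k depth_pos by (intro sum_pos) (auto simp: N_def)
  have "{-N..N} = int ` {..<2*k} \<union> (\<lambda>i. - int i) ` {..<2*k}"
  proof (intro equalityI subsetI)
    fix x assume x: "x \<in> {-N..N}"
    show "x \<in> int ` {..<2*k} \<union> (\<lambda>i. - int i) ` {..<2*k}"
    proof (cases "x \<ge> 0")
      case True
      then show ?thesis using x by (intro UnI1 image_eqI[of _ _ "nat x"]) (auto simp: N_def)
    next
      case False
      then show ?thesis using x by (intro UnI2 image_eqI[of _ _ "nat (-x)"]) (auto simp: N_def)
    qed
  qed (auto simp: N_def)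
  then have "V \<le> sum e (int ` {..<2*k}) + sum e ((\<lambda>i. - int i) ` {..<2*k})"
    unfolding V_def using depth_pos by (simp add: sum_Un sum_nonneg less_imp_le)
  also have "\<dots> = (\<Sum>i<2*k. e (int i)) + (\<Sum>i<2*k. e (- int i))"
    by (subst (1 2) sum.reindex) (auto simp: inj_on_def)
  finally have VV: "V \<le> (\<Sum>i<2*k. e (int i)) + (\<Sum>i<2*k. e (- int i))" .
  have "1 / (8 * ((\<Sum>i<2*k. e (int i)) + (\<Sum>i<2*k. e (- int i)))) \<le> 1 / (8 * V)"
    using V VV by (intro divide_left_mono) auto
  also have "\<dots> = 1 / (4 * V) / 2" by simp
  also have "\<dots> \<le> trap_heat_kernel e t 0 0"
    using kl V t by (intro heat_kernel_ge_half_of_kern_ge) (auto simp: V_def)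
  finally show ?thesis .
qed

end

section \<open>Sums of independent Pareto variables\<close>

definition pareto_density :: "real \<Rightarrow> real" where
  "pareto_density x = indicator {1..} x / x\<^sup>2"

lemma pareto_density_measurable [measurable]: "pareto_density \<in> borel_measurable borel"
  unfolding pareto_density_def by measurable

lemma pareto_density_nonneg: "pareto_density x \<ge> 0"
  by (simp add: pareto_density_def)

context prob_space
begin

text \<open>The tail formula starts at 1, where it already has the value 1; so no mass lies at or
  below 1 and the distribution function is known everywhere.\<close>

lemma pareto_distributed:
  assumes [measurable]: "X \<in> borel_measurable M"
    and tail: "\<And>u. u \<ge> 1 \<Longrightarrow> prob {\<omega> \<in> space M. X \<omega> > u} = 1 / u"
  shows "distributed M lborel X pareto_density"
proof (rule distributedI_borel_atMost)
  fix a :: real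
  show "(\<integral>\<^sup>+ x. ennreal (pareto_density x * indicator {..a} x) \<partial>lborel) = ennreal (if a < 1 then 0 else 1 - 1 / a)"
  proof (cases "a < 1")
    case True
    then have "(\<integral>\<^sup>+ x. ennreal (pareto_density x * indicator {..a} x) \<partial>lborel) = (\<integral>\<^sup>+ x. 0 \<partial>(lborel :: real measure))"
      by (intro nn_integral_cong) (auto simp: pareto_density_def indicator_def)
    then show ?thesis using True by simp
  next
    case False
    have "(\<integral>\<^sup>+ x. ennreal (pareto_density x * indicator {..a} x) \<partial>lborel)
      = (\<integral>\<^sup>+ x. ennreal (1 / x\<^sup>2) * indicator {1..a} x \<partial>lborel)"
      by (intro nn_integral_cong) (auto simp: pareto_density_def indicator_def)
    also have "\<dots> = - 1 / a - - 1 / 1"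
      by (rule nn_integral_FTC_Icc) (use False in \<open>auto intro!: derivative_eq_intros simp: power2_eq_square\<close>)
    finally show ?thesis using False by simp
  qed
  have le: "prob {\<omega> \<in> space M. X \<omega> \<le> a} = 1 - 1 / a" if "a \<ge> 1" for a
  proof -
    have "prob {\<omega> \<in> space M. X \<omega> \<le> a} = prob (space M - {\<omega> \<in> space M. X \<omega> > a})"
      by (rule arg_cong[where f = prob]) auto
    also have "\<dots> = 1 - 1 / a" using that tail by (subst prob_compl) auto
    finally show ?thesis .
  qed
  show "emeasure M {\<omega> \<in> space M. X \<omega> \<le> a} = ennreal (if a < 1 then 0 else 1 - 1 / a)"
  proof (cases "a < 1")
    case True
    have "prob {\<omega> \<in> space M. X \<omega> \<le> a} \<le> prob {\<omega> \<in> space M. X \<omega> \<le> 1}"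
      using True by (intro finite_measure_mono) auto
    then show ?thesis using True le[of 1] by (simp add: emeasure_eq_measure measure_le_0_iff)
  next
    case False
    then show ?thesis using le[of a] by (simp add: emeasure_eq_measure)
  qed
qed (auto simp: pareto_density_nonneg)

section \<open>Consequences of independence: reindexing, variance of a sum, second Borel-Cantelli
  lemma\<close>

lemma indep_sets_reindex:
  assumes f: "inj_on f I" and F: "indep_sets F (f ` I)"
  shows "indep_sets (\<lambda>i. F (f i)) I"
proof (rule indep_setsI)
  show "F (f i) \<subseteq> events" if "i \<in> I" for i
    using F that by (auto simp: indep_sets_def)
  fix A J assume J: "J \<noteq> {}" "J \<subseteq> I" "finite J" and A: "\<forall>j\<in>J. A j \<in> F (f j)"
  have inj: "inj_on f J" using f J(2) by (rule inj_on_subset)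
  define B where "B = (\<lambda>k. A (the_inv_into J f k))"
  have B: "B (f j) = A j" if "j \<in> J" for j using that inj by (simp add: B_def the_inv_into_f_f)
  have "prob (\<Inter>k\<in>f ` J. B k) = (\<Prod>k\<in>f ` J. prob (B k))"
    using J A B by (intro indep_setsD[OF F]) auto
  then show "prob (\<Inter>j\<in>J. A j) = (\<Prod>j\<in>J. prob (A j))"
    using B inj by (simp add: prod.reindex)
qed

text \<open>Serves to read the environment on \<open>int\<close> as two sequences on
  \<open>nat\<close>, one for each half-line.\<close>

lemma indep_vars_reindex:
  assumes "inj_on f I" "indep_vars M' X (f ` I)"
  shows "indep_vars (\<lambda>i. M' (f i)) (\<lambda>i. X (f i)) I"
  using assms indep_sets_reindex[OF assms(1), of "\<lambda>i. {X i -` A \<inter> space M |A. A \<in> sets (M' i)}"]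
  unfolding indep_vars_def2 by auto

text \<open>Bienayme's identity. Square-integrability of the partial sum goes through the induction
  together with it, since the next variance is computed from it.\<close>

lemma variance_sum_indep:
  fixes X :: "'i \<Rightarrow> 'a \<Rightarrow> real"
  assumes "finite I" "indep_vars (\<lambda>_. borel) X I"
    and "\<And>i. i \<in> I \<Longrightarrow> integrable M (X i)" "\<And>i. i \<in> I \<Longrightarrow> integrable M (\<lambda>\<omega>. (X i \<omega>)\<^sup>2)"
  shows "integrable M (\<lambda>\<omega>. (\<Sum>i\<in>I. X i \<omega>)\<^sup>2) \<and> variance (\<lambda>\<omega>. \<Sum>i\<in>I. X i \<omega>) = (\<Sum>i\<in>I. variance (X i))"
  using assms
proof (induction I rule: finite_induct)
  case (insert j I)
  let ?S = "\<lambda>\<omega>. \<Sum>i\<in>I. X i \<omega>"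
  have ind: "indep_var borel (X j) borel ?S"
    using insert by (intro indep_vars_sum) auto
  have IH: "integrable M (\<lambda>\<omega>. (?S \<omega>)\<^sup>2)" "variance ?S = (\<Sum>i\<in>I. variance (X i))"
    using insert.IH insert.prems indep_vars_subset[OF insert.prems(1), of I] by auto
  have int: "integrable M (X j)" "integrable M ?S" "integrable M (\<lambda>\<omega>. (X j \<omega>)\<^sup>2)"
    using insert.prems by auto
  have prod: "integrable M (\<lambda>\<omega>. X j \<omega> * ?S \<omega>)"
    "expectation (\<lambda>\<omega>. X j \<omega> * ?S \<omega>) = expectation (X j) * expectation ?S"
    using ind int by (intro indep_var_integrable indep_var_lebesgue_integral; simp)+
  have sq: "(X j \<omega> + ?S \<omega>)\<^sup>2 = (X j \<omega>)\<^sup>2 + (?S \<omega>)\<^sup>2 + 2 * (X j \<omega> * ?S \<omega>)" for \<omega>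
    by (simp add: power2_sum)
  have i2: "integrable M (\<lambda>\<omega>. (X j \<omega> + ?S \<omega>)\<^sup>2)"
    unfolding sq using int IH prod by (intro Bochner_Integration.integrable_add integrable_mult_right)
  have "variance (\<lambda>\<omega>. X j \<omega> + ?S \<omega>) = variance (X j) + variance ?S"
  proof -
    have "expectation (\<lambda>\<omega>. (X j \<omega> + ?S \<omega>)\<^sup>2) =
      expectation (\<lambda>\<omega>. (X j \<omega>)\<^sup>2) + expectation (\<lambda>\<omega>. (?S \<omega>)\<^sup>2) + 2 * (expectation (X j) * expectation ?S)"
      unfolding sq using int IH(1) prod by simp
    moreover have "expectation (\<lambda>\<omega>. X j \<omega> + ?S \<omega>) = expectation (X j) + expectation ?S"
      using int(1,2) by (rule Bochner_Integration.integral_add)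
    ultimately show ?thesis
      using variance_eq[OF Bochner_Integration.integrable_add[OF int(1,2)] i2]
        variance_eq[OF int(1,3)] variance_eq[OF int(2) IH(1)]
      by (simp only: power2_sum)
  qed
  then show ?case using insert.hyps i2 IH(2) by simp
qed (simp add: prob_space)

text \<open>By independence and \<open>1 - x \<le> exp (- x)\<close>, the event \<open>B m\<close>
  of no exceedance from \<open>m\<close> on has probability at most \<open>exp\<close> of minus any
  partial sum. Were it positive, minus its logarithm would bound all partial sums.\<close>

lemma AE_frequently_of_not_summable:
  fixes Y :: "nat \<Rightarrow> 'a \<Rightarrow> real"
  assumes indep: "indep_vars (\<lambda>_. borel) Y UNIV"
    and div: "\<not> summable (\<lambda>n. prob {\<omega> \<in> space M. Y n \<omega> > c n})"
  shows "AE \<omega> in M. \<exists>\<^sub>F n in sequentially. Y n \<omega> > c n"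
proof -
  have [measurable]: "\<And>n. Y n \<in> borel_measurable M" using indep by (auto simp: indep_vars_def)
  define p where "p = (\<lambda>n. prob {\<omega> \<in> space M. Y n \<omega> > c n})"
  define B where "B = (\<lambda>m. {\<omega> \<in> space M. \<forall>n\<ge>m. \<not> Y n \<omega> > c n})"
  have Bm [measurable]: "B m \<in> events" for m unfolding B_def by measurable
  have "prob (B m) = 0" for m
  proof (rule ccontr)
    assume "prob (B m) \<noteq> 0"
    then have pos: "prob (B m) > 0" using measure_nonneg[of M "B m"] by linarith
    have bound: "(\<Sum>n<k. p (n + m)) \<le> - ln (prob (B m))" for k
    proof (cases "k = 0")
      case True
      then show ?thesis using pos by simp
    next
      case False
      have "B m \<subseteq> (\<Inter>n\<in>{m..<m+k}. Y n -` {..c n} \<inter> space M)"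
        using False by (auto simp: B_def not_less)
      then have "prob (B m) \<le> prob (\<Inter>n\<in>{m..<m+k}. Y n -` {..c n} \<inter> space M)"
        using False by (intro finite_measure_mono) (auto intro!: sets.finite_INT)
      also have "\<dots> = (\<Prod>n\<in>{m..<m+k}. prob (Y n -` {..c n} \<inter> space M))"
        using False by (intro indep_varsD[OF indep]) auto
      also have "\<dots> = (\<Prod>n\<in>{m..<m+k}. 1 - p n)"
      proof (rule prod.cong)
        fix n
        have "Y n -` {..c n} \<inter> space M = space M - {\<omega> \<in> space M. Y n \<omega> > c n}" by auto
        then show "prob (Y n -` {..c n} \<inter> space M) = 1 - p n" by (simp add: p_def prob_compl)
      qed simp
      also have "\<dots> \<le> (\<Prod>n\<in>{m..<m+k}. exp (- p n))"
      proof (rule prod_mono)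
        fix n
        show "0 \<le> 1 - p n \<and> 1 - p n \<le> exp (- p n)"
          using exp_ge_add_one_self[of "- p n"] by (simp add: p_def)
      qed
      also have "\<dots> = exp (- (\<Sum>n\<in>{m..<m+k}. p n))" by (simp add: exp_sum sum_negf[symmetric])
      also have "(\<Sum>n\<in>{m..<m+k}. p n) = (\<Sum>n<k. p (n + m))"
        using sum.shift_bounds_nat_ivl[of p 0 m k] by (simp add: atLeast0LessThan add.commute)
      finally have "ln (prob (B m)) \<le> ln (exp (- (\<Sum>n<k. p (n + m))))"
        using pos by (subst ln_le_cancel_iff) auto
      then show ?thesis by simp
    qed
    have "summable (\<lambda>n. p (n + m))"
      using bound[of "Suc _"]
      by (intro bounded_imp_summable[where B = "- ln (prob (B m))"]) (simp_all only: lessThan_Suc_atMost, simp add: p_def)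
    then have "summable p" by (simp add: summable_iff_shift)
    with div show False by (simp add: p_def)
  qed
  then have "AE \<omega> in M. \<omega> \<notin> B m" for m by (simp add: prob_eq_0)
  then have "AE \<omega> in M. \<forall>m. \<omega> \<notin> B m" by (simp add: AE_all_countable)
  then show ?thesis
    by (rule AE_mp) (auto simp: B_def frequently_sequentially intro!: AE_I2)
qed

end

section \<open>Tail bounds for one-sided sums by truncation\<close>

locale pareto_sequence = prob_space +
  fixes Y :: "nat \<Rightarrow> 'a \<Rightarrow> real"
  assumes indep: "indep_vars (\<lambda>_. borel) Y UNIV"
    and tail: "u \<ge> 1 \<Longrightarrow> prob {\<omega> \<in> space M. Y i \<omega> > u} = 1 / u"
begin

lemma measurable_Y [measurable]: "Y i \<in> borel_measurable M"
  using indep by (auto simp: indep_vars_def)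

lemma Y_distributed: "distributed M lborel (Y i) pareto_density"
  by (rule pareto_distributed) (use tail in auto)

lemma AE_Y_gt_1: "AE \<omega> in M. \<forall>i. Y i \<omega> > 1"
proof -
  have "AE \<omega> in M. Y i \<omega> > 1" for i
    using tail[of 1 i] by (simp add: prob_eq_1)
  then show ?thesis by (simp add: AE_all_countable)
qed

text \<open>Depths beyond \<open>c\<close> become 0 and not \<open>c\<close>: the moments are then
  plain integrals over \<open>[1, c]\<close>, and a sum of truncated depths agrees with the full sum
  when no trap exceeds \<open>c\<close>.\<close>

definition trunc :: "real \<Rightarrow> nat \<Rightarrow> 'a \<Rightarrow> real" where
  "trunc c i \<omega> = (if Y i \<omega> \<le> c then Y i \<omega> else 0)"

lemma measurable_trunc [measurable]: "trunc c i \<in> borel_measurable M"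
  unfolding trunc_def by measurable

text \<open>Against the density \<open>1 / x^2\<close> the moments are the integrals of
  \<open>1 / x\<close> and of 1 over \<open>[1, c]\<close>. The logarithm in \<open>phi1\<close>
  originates here.\<close>

lemma trunc_moments:
  assumes c: "c \<ge> 1"
  shows "integrable M (trunc c i)" "expectation (trunc c i) = ln c"
    "integrable M (\<lambda>\<omega>. (trunc c i \<omega>)\<^sup>2)" "expectation (\<lambda>\<omega>. (trunc c i \<omega>)\<^sup>2) = c - 1"
proof -
  define g where "g = (\<lambda>y::real. if y \<le> c then y else 0)"
  have g [measurable]: "g \<in> borel_measurable borel" unfolding g_def by measurable
  have tr: "trunc c i \<omega> = g (Y i \<omega>)" for \<omega> by (simp add: trunc_def g_def)
  have h1: "has_bochner_integral lborel (\<lambda>x. 1 / x * indicator {1..c} x) (ln c - ln 1)"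
    by (rule has_bochner_integral_FTC_Icc_real) (use c in \<open>auto intro!: derivative_eq_intros continuous_intros\<close>)
  have h2: "has_bochner_integral lborel (\<lambda>x. 1 * indicator {1..c} x) (c - 1)"
    by (rule has_bochner_integral_FTC_Icc_real) (use c in \<open>auto intro!: derivative_eq_intros continuous_intros\<close>)
  have e1: "pareto_density x * g x = 1 / x * indicator {1..c} x" for x
    by (simp add: pareto_density_def g_def indicator_def power2_eq_square)
  have e2: "pareto_density x * (g x)\<^sup>2 = 1 * indicator {1..c} x" for x
    by (simp add: pareto_density_def g_def indicator_def power2_eq_square)
  note D = distributed_integrable[OF Y_distributed[of i]] distributed_integral[OF Y_distributed[of i]]
  show "integrable M (trunc c i)" "expectation (trunc c i) = ln c"
    using D(1)[of g] D(2)[of g] h1 unfolding e1 tr[abs_def]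
    by (auto simp: pareto_density_nonneg has_bochner_integral_iff)
  show "integrable M (\<lambda>\<omega>. (trunc c i \<omega>)\<^sup>2)" "expectation (\<lambda>\<omega>. (trunc c i \<omega>)\<^sup>2) = c - 1"
    using D(1)[of "\<lambda>x. (g x)\<^sup>2"] D(2)[of "\<lambda>x. (g x)\<^sup>2"] h2 unfolding e2 tr[abs_def]
    by (auto simp: pareto_density_nonneg has_bochner_integral_iff)
qed

lemma trunc_sum_deviation:
  assumes c: "c \<ge> 1" and a: "a > 0"
  shows "prob {\<omega> \<in> space M. \<bar>(\<Sum>i<n. trunc c i \<omega>) - real n * ln c\<bar> \<ge> a} \<le> real n * c / a\<^sup>2"
proof -
  have ind: "indep_vars (\<lambda>_. borel) (trunc c) {..<n}"
  proof (rule indep_vars_subset)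
    have "indep_vars (\<lambda>_. borel) (\<lambda>i \<omega>. (\<lambda>y. if y \<le> c then y else 0) (Y i \<omega>)) UNIV"
      by (rule indep_vars_compose2[OF indep]) measurable
    then show "indep_vars (\<lambda>_. borel) (trunc c) UNIV" by (simp add: trunc_def[abs_def])
  qed simp
  note m = trunc_moments[OF c]
  have V: "integrable M (\<lambda>\<omega>. (\<Sum>i<n. trunc c i \<omega>)\<^sup>2)"
    "variance (\<lambda>\<omega>. \<Sum>i<n. trunc c i \<omega>) = (\<Sum>i<n. variance (trunc c i))"
    using variance_sum_indep[OF _ ind m(1,3)] by auto
  have "variance (trunc c i) \<le> c" for i
    using variance_eq[OF m(1,3), of i] m(4)[of i] zero_le_power2[of "expectation (trunc c i)"] by linarith
  then have "(\<Sum>i<n. variance (trunc c i)) \<le> (\<Sum>i<n. c)" by (intro sum_mono)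
  then have var: "variance (\<lambda>\<omega>. \<Sum>i<n. trunc c i \<omega>) \<le> real n * c" using V(2) by simp
  have ex: "expectation (\<lambda>\<omega>. \<Sum>i<n. trunc c i \<omega>) = real n * ln c"
    using m(1,2) by simp
  have "prob {\<omega> \<in> space M. \<bar>(\<Sum>i<n. trunc c i \<omega>) - expectation (\<lambda>\<omega>. \<Sum>i<n. trunc c i \<omega>)\<bar> \<ge> a}
    \<le> variance (\<lambda>\<omega>. \<Sum>i<n. trunc c i \<omega>) / a\<^sup>2"
    by (rule Chebyshev_inequality[OF _ V(1) a]) measurable
  also have "\<dots> \<le> real n * c / a\<^sup>2" using var by (intro divide_right_mono) auto
  finally show ?thesis unfolding ex .
qed

abbreviation S :: "nat \<Rightarrow> 'a \<Rightarrow> real" where "S n \<omega> \<equiv> (\<Sum>i<n. Y i \<omega>)"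

text \<open>Either some trap is deeper than \<open>c\<close>, or the truncated sum exceeds its mean
  by \<open>c\<close>. The union bound and Chebyshev's inequality cost \<open>n / c\<close>
  each.\<close>

lemma S_upper_tail:
  assumes c: "c \<ge> 1"
  shows "prob {\<omega> \<in> space M. S n \<omega> > real n * ln c + c} \<le> 2 * real n / c"
proof -
  let ?A = "\<Union>i<n. {\<omega> \<in> space M. Y i \<omega> > c}"
  let ?B = "{\<omega> \<in> space M. \<bar>(\<Sum>i<n. trunc c i \<omega>) - real n * ln c\<bar> \<ge> c}"
  have "{\<omega> \<in> space M. S n \<omega> > real n * ln c + c} \<subseteq> ?A \<union> ?B"
  proof
    fix \<omega> assume w: "\<omega> \<in> {\<omega> \<in> space M. S n \<omega> > real n * ln c + c}"
    show "\<omega> \<in> ?A \<union> ?B"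
    proof (cases "\<omega> \<in> ?A")
      case False
      then have "S n \<omega> \<le> (\<Sum>i<n. trunc c i \<omega>)"
        using w by (intro sum_mono) (auto simp: trunc_def not_less)
      then show ?thesis using w by auto
    qed simp
  qed
  then have "prob {\<omega> \<in> space M. S n \<omega> > real n * ln c + c} \<le> prob (?A \<union> ?B)"
    by (intro finite_measure_mono) auto
  also have "\<dots> \<le> prob ?A + prob ?B" by (intro measure_Un_le) auto
  also have "prob ?A \<le> (\<Sum>i<n. prob {\<omega> \<in> space M. Y i \<omega> > c})"
    by (intro measure_UNION_le) auto
  also have "\<dots> = real n / c" using tail c by simp
  also have "prob ?B \<le> real n * c / c\<^sup>2" using c by (intro trunc_sum_deviation) auto
  also have "real n / c + real n * c / c\<^sup>2 = 2 * real n / c"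
    using c by (simp add: power2_eq_square field_simps)
  finally show ?thesis by simp
qed

text \<open>Truncation lowers a sum of positive depths, so a small sum forces the truncated one to
  half of its mean. Positivity holds almost surely only and is thus made part of the event.\<close>

lemma S_lower_tail:
  assumes c: "c > 1" and n: "n \<ge> 1"
  shows "prob {\<omega> \<in> space M. (\<forall>i. Y i \<omega> > 1) \<and> S n \<omega> < real n * ln c / 2} \<le> 4 * c / (real n * (ln c)\<^sup>2)"
proof -
  have "{\<omega> \<in> space M. (\<forall>i. Y i \<omega> > 1) \<and> S n \<omega> < real n * ln c / 2}
    \<subseteq> {\<omega> \<in> space M. \<bar>(\<Sum>i<n. trunc c i \<omega>) - real n * ln c\<bar> \<ge> real n * ln c / 2}"
  proof safe
    fix \<omega> assume w: "\<forall>i. Y i \<omega> > 1" "S n \<omega> < real n * ln c / 2"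
    have "(\<Sum>i<n. trunc c i \<omega>) \<le> S n \<omega>"
      using w(1) by (intro sum_mono) (auto simp: trunc_def intro: order_trans[OF zero_le_one less_imp_le])
    then show "\<bar>(\<Sum>i<n. trunc c i \<omega>) - real n * ln c\<bar> \<ge> real n * ln c / 2"
      using w(2) by linarith
  qed
  then have "prob {\<omega> \<in> space M. (\<forall>i. Y i \<omega> > 1) \<and> S n \<omega> < real n * ln c / 2} \<le>
      prob {\<omega> \<in> space M. \<bar>(\<Sum>i<n. trunc c i \<omega>) - real n * ln c\<bar> \<ge> real n * ln c / 2}"
    by (intro finite_measure_mono) auto
  also have "\<dots> \<le> real n * c / (real n * ln c / 2)\<^sup>2"
    using c n by (intro trunc_sum_deviation) auto
  also have "\<dots> = 4 * c / (real n * (ln c)\<^sup>2)"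
    using c n by (simp add: power2_eq_square field_simps)
  finally show ?thesis .
qed

end

section \<open>Almost sure growth of the volume\<close>

lemma eventually_between_powers:
  fixes b :: nat
  assumes b: "b \<ge> 2"
    and ev: "\<forall>\<^sub>F k in sequentially. \<forall>n. b ^ k \<le> n \<longrightarrow> n < b ^ Suc k \<longrightarrow> P n"
  shows "\<forall>\<^sub>F n in sequentially. P n"
proof -
  obtain K where K: "\<And>k n. k \<ge> K \<Longrightarrow> b ^ k \<le> n \<Longrightarrow> n < b ^ Suc k \<Longrightarrow> P n"
    using ev unfolding eventually_sequentially by blast
  have "P n" if n: "n \<ge> b ^ K" for n
  proof -
    have "n \<ge> 1" using n b by (metis le_trans one_le_power one_le_numeral)
    then obtain k where k: "b ^ k \<le> n" "n < b ^ (k + 1)"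
      using ex_power_ivl1[OF b, of n] by auto
    have "b ^ K < b ^ (k + 1)" using n k(2) by linarith
    then have "K < Suc k" unfolding Suc_eq_plus1 using b by (simp only: power_strict_increasing_iff)
    then show ?thesis using K[of k n] k by simp
  qed
  then show ?thesis unfolding eventually_sequentially by blast
qed

text \<open>Comparison with the telescoping decrements of \<open>1 / ln\<close>; the shift by 2
  keeps the logarithms positive from \<open>n = 0\<close> on.\<close>

lemma summable_inverse_n_ln_squared: "summable (\<lambda>n. 1 / (real n * (ln (real n))\<^sup>2))"
proof (rule summable_comparison_test_bigo)
  have "(\<lambda>n. 1 / ln (real n + 2)) \<longlonglongrightarrow> 0" by real_asymp
  then have "summable (\<lambda>n. 1 / ln (real n + 2) - 1 / ln (real (Suc n) + 2))"
    by (rule telescope_summable')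
  moreover have "norm (1 / ln (real n + 2) - 1 / ln (real (Suc n) + 2)) = 1 / ln (real n + 2) - 1 / ln (real (Suc n) + 2)" for n
  proof -
    have "1 / ln (real (Suc n) + 2) \<le> 1 / ln (real n + 2)" by (intro divide_left_mono) auto
    then show ?thesis by simp
  qed
  ultimately show "summable (\<lambda>n. norm (1 / ln (real n + 2) - 1 / ln (real (Suc n) + 2)))" by simp
  show "(\<lambda>n. 1 / (real n * (ln (real n))\<^sup>2)) \<in> O(\<lambda>n. 1 / ln (real n + 2) - 1 / ln (real (Suc n) + 2))"
    unfolding of_nat_Suc by real_asymp
qed

text \<open>The terms dominate the increments of the triple logarithm up to a constant. Convergence
  would make the triple logarithm converge, but it tends to infinity.\<close>

lemma not_summable_inverse_n_ln_lnln: "\<not> summable (\<lambda>n. 1 / (real n * ln (real n) * ln (ln (real n))))"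
proof
  let ?f = "\<lambda>n. 1 / (real n * ln (real n) * ln (ln (real n)))"
  let ?L = "\<lambda>n. ln (ln (ln (real n)))"
  assume s: "summable ?f"
  have "\<forall>\<^sub>F n in sequentially. ?f n = norm (?f n)"
  proof -
    have "\<forall>\<^sub>F n in sequentially. ?f n > 0" by real_asymp
    then show ?thesis by (rule eventually_mono) (simp only: real_norm_def abs_of_pos)
  qed
  then have "summable (\<lambda>n. norm (?f n))" using s by (subst (asm) summable_cong) auto
  moreover have "(\<lambda>n. ?L (Suc n) - ?L n) \<in> O(?f)" unfolding of_nat_Suc by real_asymp
  ultimately have "summable (\<lambda>n. ?L (Suc n) - ?L n)" by (rule summable_comparison_test_bigo)
  then have "(\<lambda>n. \<Sum>k<n. ?L (Suc k) - ?L k) \<longlonglongrightarrow> (\<Sum>k. ?L (Suc k) - ?L k)"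
    by (simp only: summable_LIMSEQ)
  then have "convergent (\<lambda>n. ?L n - ?L 0)" by (subst (asm) sum_lessThan_telescope) (auto simp: convergent_def)
  moreover have "filterlim (\<lambda>n. ?L n - ?L 0) at_infinity sequentially"
    by (rule filterlim_at_top_imp_at_infinity) real_asymp
  ultimately show False using not_tendsto_and_filterlim_at_infinity[OF sequentially_bot] by (auto simp: convergent_def)
qed

context pareto_sequence
begin

lemma S_mono:
  assumes "\<forall>i. Y i \<omega> > 1" "m \<le> n"
  shows "S m \<omega> \<le> S n \<omega>"
proof (rule sum_mono2)
  fix i assume "i \<in> {..<n} - {..<m}"
  show "0 \<le> Y i \<omega>" using assms(1)[rule_format, of i] by linarith
qed (use assms in auto)

text \<open>Cutting \<open>4 ^ k\<close> traps at \<open>2 ^ k\<close>, the square root of their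
  number, keeps half of the logarithm and makes the failure probabilities geometric. In 32, a factor
  2 comes from the deviation, 2 from the square root, 4 from the block length and 2 from
  \<open>k + 1 \<le> 2 * k\<close>.\<close>

lemma AE_S_lower: "AE \<omega> in M. \<forall>\<^sub>F n in sequentially. S n \<omega> \<ge> real n * ln (real n) / 32"
proof -
  let ?B = "\<lambda>k. {\<omega> \<in> space M. (\<forall>i. Y i \<omega> > 1) \<and> S (4 ^ k) \<omega> < real (4 ^ k) * ln (2 ^ k) / 2}"
  have "summable (\<lambda>k. prob (?B k))"
  proof (rule summable_comparison_test_ev)
    show "summable (\<lambda>k. 4 / (ln 2)\<^sup>2 * (1 / 2) ^ k :: real)" by (intro summable_mult summable_geometric) simp
    show "\<forall>\<^sub>F k in sequentially. norm (prob (?B k)) \<le> 4 / (ln 2)\<^sup>2 * (1 / 2) ^ k"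
      using eventually_ge_at_top[of 1]
    proof eventually_elim
      case (elim k)
      have "prob (?B k) \<le> 4 * 2 ^ k / (real (4 ^ k) * (ln (2 ^ k))\<^sup>2)"
        using elim by (intro S_lower_tail) (auto simp: one_less_power)
      also have "\<dots> = 4 * (2 ^ k / 4 ^ k) / (real k * ln 2)\<^sup>2" by (simp add: ln_realpow field_simps)
      also have "\<dots> = 4 * (1 / 2) ^ k / (real k * ln 2)\<^sup>2"
        by (simp flip: power_divide)
      also have "\<dots> \<le> 4 * (1 / 2) ^ k / (1 * ln 2)\<^sup>2"
        using elim by (intro divide_left_mono power_mono mult_right_mono) auto
      finally show ?case by simp
    qed
  qed
  then have "AE \<omega> in M. \<forall>\<^sub>F k in sequentially. \<omega> \<in> space M - ?B k"
    by (intro borel_cantelli_AE1) (auto simp: emeasure_eq_measure)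
  with AE_Y_gt_1 show ?thesis
  proof eventually_elim
    case (elim \<omega>)
    have "\<forall>\<^sub>F k in sequentially. \<forall>n. 4 ^ k \<le> n \<longrightarrow> n < 4 ^ Suc k \<longrightarrow> S n \<omega> \<ge> real n * ln (real n) / 32"
      using elim(2) eventually_ge_at_top[of 1]
    proof eventually_elim
      case inner: (elim k)
      show ?case
      proof (intro allI impI)
        fix n :: nat assume n: "4 ^ k \<le> n" "n < 4 ^ Suc k"
        have n1: "real n \<ge> 1" using n(1) by (metis one_le_power le_trans one_le_numeral of_nat_1 of_nat_le_iff)
        have n2: "real n \<le> 4 ^ Suc k" using n(2) by (metis less_imp_le of_nat_le_iff of_nat_numeral of_nat_power)
        have "real n * ln (real n) \<le> 4 ^ Suc k * ln (4 ^ Suc k)"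
          using n1 n2 by (intro mult_mono) auto
        also have "ln (4 ^ Suc k :: real) = real (Suc k) * (2 * ln 2)"
          using ln_realpow[of 2 2] by (simp add: ln_realpow del: of_nat_Suc power_Suc)
        also have "4 ^ Suc k * (real (Suc k) * (2 * ln 2)) \<le> 4 ^ Suc k * (2 * real k * (2 * ln 2))"
          using inner by (intro mult_left_mono mult_right_mono) auto
        also have "\<dots> / 32 = real (4 ^ k) * ln (2 ^ k) / 2" by (simp add: ln_realpow)
        finally have "real n * ln (real n) / 32 \<le> real (4 ^ k) * ln (2 ^ k) / 2" by simp
        also have "\<dots> \<le> S (4 ^ k) \<omega>" using inner elim(1) by (auto simp: not_less)
        also have "\<dots> \<le> S n \<omega>" using elim(1) n(1) by (rule S_mono)
        finally show "S n \<omega> \<ge> real n * ln (real n) / 32" .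
      qed
    qed
    then show ?case by (rule eventually_between_powers[rotated]) simp
  qed
qed

text \<open>At scale \<open>2 ^ k\<close> the level \<open>c k\<close> fails with probability at
  most \<open>2 / (k (ln k)^2)\<close>, which is summable. As \<open>k\<close> is of order
  \<open>ln n\<close>, this is the source of the squared iterated logarithm.\<close>

lemma AE_S_upper:
  "AE \<omega> in M. \<forall>\<^sub>F n in sequentially. S n \<omega> \<le> 8 * real n * ln (real n) * (ln (ln (real n)))\<^sup>2"
proof -
  define c where "c = (\<lambda>k. 2 ^ k * (real k * (ln (real k))\<^sup>2))"
  let ?B = "\<lambda>k. {\<omega> \<in> space M. S (2 ^ k) \<omega> > real (2 ^ k) * ln (c k) + c k}"
  have c1: "\<forall>\<^sub>F k in sequentially. c k \<ge> 1" unfolding c_def by real_asymp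
  have "summable (\<lambda>k. prob (?B k))"
  proof (rule summable_comparison_test_ev)
    show "summable (\<lambda>k. 2 * (1 / (real k * (ln (real k))\<^sup>2)))"
      by (intro summable_mult summable_inverse_n_ln_squared)
    show "\<forall>\<^sub>F k in sequentially. norm (prob (?B k)) \<le> 2 * (1 / (real k * (ln (real k))\<^sup>2))"
      using c1
    proof eventually_elim
      case (elim k)
      have "prob (?B k) \<le> 2 * real (2 ^ k) / c k" by (rule S_upper_tail[OF elim])
      then show ?case by (simp add: c_def)
    qed
  qed
  then have "AE \<omega> in M. \<forall>\<^sub>F k in sequentially. \<omega> \<in> space M - ?B k"
    by (intro borel_cantelli_AE1) (auto simp: emeasure_eq_measure)
  with AE_Y_gt_1 show ?thesis
  proof eventually_elim
    case (elim \<omega>)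
    have "\<forall>\<^sub>F k in sequentially. \<omega> \<in> space M - ?B (Suc k)"
      using elim(2) by (rule eventually_sequentially_Suc[THEN iffD2])
    \<comment> \<open>A common factor \<open>2 ^ k\<close> is removed and \<open>ln 2\<close>
      replaced by 1. The left side bounds the sum at the end \<open>2 ^ Suc k\<close> of the block;
      the right side uses \<open>ln n \<ge> k / 2\<close>. The leading terms are 2 and 4 times
      \<open>k (ln k)^2\<close>.\<close>
    moreover have "\<forall>\<^sub>F k in sequentially. 2 * ((real k + 1) + ln ((real k + 1) * (ln (real k + 1))\<^sup>2)) +
        2 * ((real k + 1) * (ln (real k + 1))\<^sup>2) \<le> 8 * (real k / 2) * (ln (real k / 2))\<^sup>2"
      by real_asymp
    moreover have "\<forall>\<^sub>F k in sequentially. real k / 2 \<ge> 1" by real_asymp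
    ultimately have "\<forall>\<^sub>F k in sequentially. \<forall>n. 2 ^ k \<le> n \<longrightarrow> n < 2 ^ Suc k \<longrightarrow>
        S n \<omega> \<le> 8 * real n * ln (real n) * (ln (ln (real n)))\<^sup>2"
    proof eventually_elim
      case inner: (elim k)
      show ?case
      proof (intro allI impI)
        fix n :: nat assume n: "2 ^ k \<le> n" "n < 2 ^ Suc k"
        have k: "k \<ge> 1" using inner(3) by (cases k) auto
        have n2: "2 ^ k \<le> real n" using n(1) by (metis of_nat_le_iff of_nat_numeral of_nat_power)
        have "real k / 2 \<le> real k * ln 2" using mult_left_mono[of "1 / 2" "ln 2" "real k"] ln2_ge_two_thirds by simp
        also have "\<dots> \<le> ln (real n)"
          using n2 by (metis ln_realpow ln_mono zero_less_numeral zero_less_power)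
        finally have ln_n: "real k / 2 \<le> ln (real n)" .
        have lnln_n: "ln (real k / 2) \<le> ln (ln (real n))" "ln (real k / 2) \<ge> 0"
          using ln_n inner(3) by (auto intro!: ln_mono)
        have ck: "c (Suc k) = 2 ^ Suc k * ((real k + 1) * (ln (real k + 1))\<^sup>2)"
          by (simp add: c_def add.commute)
        have lnc: "ln (c (Suc k)) = (real k + 1) * ln 2 + ln ((real k + 1) * (ln (real k + 1))\<^sup>2)"
          unfolding ck using k by (subst ln_mult_pos) (auto simp: ln_realpow add.commute simp del: power_Suc)
        have "S n \<omega> \<le> S (2 ^ Suc k) \<omega>" using elim(1) n(2) by (intro S_mono) auto
        also have "\<dots> \<le> real (2 ^ Suc k) * ln (c (Suc k)) + c (Suc k)"
          using inner(1) by (auto simp: not_less)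
        also have "\<dots> = 2 ^ k * (2 * ((real k + 1) * ln 2 + ln ((real k + 1) * (ln (real k + 1))\<^sup>2)) +
            2 * ((real k + 1) * (ln (real k + 1))\<^sup>2))"
          unfolding lnc unfolding ck by (simp add: algebra_simps)
        also have "\<dots> \<le> 2 ^ k * (2 * ((real k + 1) * 1 + ln ((real k + 1) * (ln (real k + 1))\<^sup>2)) +
            2 * ((real k + 1) * (ln (real k + 1))\<^sup>2))"
          using ln_2_less_1 by (intro mult_left_mono add_mono) auto
        also have "\<dots> \<le> 2 ^ k * (8 * (real k / 2) * (ln (real k / 2))\<^sup>2)"
          using inner(2) by (intro mult_left_mono) auto
        also have "\<dots> = 8 * 2 ^ k * (real k / 2) * (ln (real k / 2))\<^sup>2" by simp
        also have "\<dots> \<le> 8 * real n * ln (real n) * (ln (ln (real n)))\<^sup>2"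
          using n2 ln_n lnln_n inner(3) by (intro mult_mono power_mono) auto
        finally show "S n \<omega> \<le> 8 * real n * ln (real n) * (ln (ln (real n)))\<^sup>2" .
      qed
    qed
    then show ?case by (rule eventually_between_powers[rotated]) simp
  qed
qed

text \<open>For \<open>n = 2 ^ (m^2)\<close> the logarithm of \<open>n\<close> is of order
  \<open>m^2\<close>, so the level \<open>n m^2\<close> is still of order \<open>n ln n\<close>,
  while its failure probability \<open>2 / m^2\<close> is summable. Sparse scales thus replace the
  iterated logarithms.\<close>

lemma AE_S_upper_subseq:
  "AE \<omega> in M. \<forall>\<^sub>F m in sequentially. S (2 ^ (m\<^sup>2)) \<omega> \<le> 6 * real (2 ^ (m\<^sup>2)) * ln (real (2 ^ (m\<^sup>2)))"
proof -
  define c where "c = (\<lambda>m::nat. real (2 ^ (m\<^sup>2)) * (real m)\<^sup>2)"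
  let ?B = "\<lambda>m. {\<omega> \<in> space M. S (2 ^ (m\<^sup>2)) \<omega> > real (2 ^ (m\<^sup>2)) * ln (c m) + c m}"
  have "summable (\<lambda>m. prob (?B m))"
  proof (rule summable_comparison_test_ev)
    show "summable (\<lambda>m. 2 * (1 / (real m)\<^sup>2))"
      using inverse_power_summable[of 2, where ?'a = real] by (intro summable_mult) (simp add: field_simps)
    show "\<forall>\<^sub>F m in sequentially. norm (prob (?B m)) \<le> 2 * (1 / (real m)\<^sup>2)"
      using eventually_ge_at_top[of 1]
    proof eventually_elim
      case (elim m)
      have "1 * 1 \<le> c m" unfolding c_def using elim by (intro mult_mono) auto
      then have "prob (?B m) \<le> 2 * real (2 ^ (m\<^sup>2)) / c m" by (intro S_upper_tail) simp
      then show ?case by (simp add: c_def)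
    qed
  qed
  then have "AE \<omega> in M. \<forall>\<^sub>F k in sequentially. \<omega> \<in> space M - ?B k"
    by (intro borel_cantelli_AE1) (auto simp: emeasure_eq_measure)
  then show ?thesis
  proof eventually_elim
    case (elim \<omega>)
    moreover have "\<forall>\<^sub>F m in sequentially. (real m)\<^sup>2 + 2 * ln (real m) + (real m)\<^sup>2 \<le> 3 * (real m)\<^sup>2"
      by real_asymp
    ultimately show ?case using eventually_ge_at_top[of 1]
    proof eventually_elim
      case inner: (elim m)
      have l2: "ln (real (2 ^ (m\<^sup>2))) = (real m)\<^sup>2 * ln 2" by (simp add: ln_realpow)
      have lnc: "ln (c m) = (real m)\<^sup>2 * ln 2 + 2 * ln (real m)"
        unfolding c_def using inner(3) by (subst ln_mult_pos) (auto simp: ln_realpow)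
      have "S (2 ^ (m\<^sup>2)) \<omega> \<le> real (2 ^ (m\<^sup>2)) * ln (c m) + c m"
        using inner(1) by (auto simp: not_less)
      also have "\<dots> = real (2 ^ (m\<^sup>2)) * ((real m)\<^sup>2 * ln 2 + 2 * ln (real m) + (real m)\<^sup>2)"
        unfolding lnc by (simp add: c_def algebra_simps)
      also have "\<dots> \<le> real (2 ^ (m\<^sup>2)) * ((real m)\<^sup>2 * 1 + 2 * ln (real m) + (real m)\<^sup>2)"
        using ln_2_less_1 by (intro mult_left_mono add_mono) auto
      also have "\<dots> \<le> real (2 ^ (m\<^sup>2)) * (3 * (real m)\<^sup>2)"
        using inner(2) by (intro mult_left_mono) auto
      also have "\<dots> \<le> real (2 ^ (m\<^sup>2)) * (6 * ((real m)\<^sup>2 * ln 2))"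
      proof (rule mult_left_mono)
        have "(real m)\<^sup>2 * (1 / 2) \<le> (real m)\<^sup>2 * ln 2"
          using ln2_ge_two_thirds by (intro mult_left_mono) auto
        then show "3 * (real m)\<^sup>2 \<le> 6 * ((real m)\<^sup>2 * ln 2)" by linarith
      qed simp
      finally show ?case unfolding l2 by simp
    qed
  qed
qed

text \<open>The factor runs through the naturals, so that countably many almost sure events combine;
  adding 1 keeps the threshold eventually in the range of the tail formula.\<close>

lemma AE_frequently_large:
  "AE \<omega> in M. \<forall>C::nat. \<exists>\<^sub>F n in sequentially. Y n \<omega> > (real C + 1) * (real n * ln (real n) * ln (ln (real n)))"
proof -
  have "AE \<omega> in M. \<exists>\<^sub>F n in sequentially. Y n \<omega> > (real C + 1) * (real n * ln (real n) * ln (ln (real n)))" for C :: nat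
  proof (rule AE_frequently_of_not_summable[OF indep])
    let ?c = "\<lambda>n::nat. (real C + 1) * (real n * ln (real n) * ln (ln (real n)))"
    have g: "\<forall>\<^sub>F n::nat in sequentially. real n * ln (real n) * ln (ln (real n)) \<ge> 1" by real_asymp
    have "\<forall>\<^sub>F n in sequentially. prob {\<omega> \<in> space M. Y n \<omega> > ?c n} = inverse (real C + 1) * (1 / (real n * ln (real n) * ln (ln (real n))))"
      using g
    proof eventually_elim
      case (elim n)
      have "1 * 1 \<le> ?c n" using elim by (intro mult_mono) auto
      then show ?case by (subst tail) (auto simp: field_simps)
    qed
    then have "summable (\<lambda>n. prob {\<omega> \<in> space M. Y n \<omega> > ?c n}) \<longleftrightarrow>
        summable (\<lambda>n. inverse (real C + 1) * (1 / (real n * ln (real n) * ln (ln (real n)))))"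
      by (rule summable_cong)
    also have "\<dots> \<longleftrightarrow> summable (\<lambda>n. 1 / (real n * ln (real n) * ln (ln (real n))))"
      by (subst summable_cmult_iff) auto
    finally show "\<not> summable (\<lambda>n. prob {\<omega> \<in> space M. Y n \<omega> > ?c n})"
      using not_summable_inverse_n_ln_lnln by blast
  qed
  then show ?thesis by (simp add: AE_all_countable)
qed

end

section \<open>Asymptotics of the heat kernel\<close>

lemma frequently_filterlim:
  assumes "filterlim g G F" "\<exists>\<^sub>F x in F. P (g x)"
  shows "\<exists>\<^sub>F y in G. P y"
  using assms(2) eventually_compose_filterlim[OF _ assms(1), of "\<lambda>y. \<not> P y"]
  unfolding frequently_def by blast

lemma phi1_eq: "t > 1 \<Longrightarrow> phi1 t = 1 / sqrt (t * ln t)"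
  by (simp add: phi1_def powr_minus_divide powr_half_sqrt real_sqrt_mult)

lemma phi1_nonneg: "phi1 t \<ge> 0"
  by (simp add: phi1_def)

context trap_environment
begin

abbreviation "right_sum \<equiv> (\<lambda>n. \<Sum>i<n. e (int i))"
abbreviation "left_sum \<equiv> (\<lambda>n. \<Sum>i<n. e (- int i))"
abbreviation "p \<equiv> (\<lambda>t. trap_heat_kernel e t 0 0)"

text \<open>\<open>q = sqrt (t / ln t)\<close> balances the two terms: both
  \<open>1 / (r ln r)\<close> and \<open>r / t\<close> are of order \<open>1 / (q ln t)\<close>, and
  \<open>q ln t = sqrt (t ln t)\<close>. By \<open>ln r \<ge> ln t / 4\<close> the volume is at
  least \<open>q ln t / 128\<close>, and \<open>264 = 2 * 128 + 4 * 2\<close>.\<close>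

lemma eventually_heat_kernel_upper:
  assumes low: "\<forall>\<^sub>F n in sequentially. right_sum n \<ge> real n * ln (real n) / 32"
  shows "\<forall>\<^sub>F t in at_top. p t / phi1 t \<le> 264"
proof -
  define q where "q = (\<lambda>t::real. sqrt (t / ln t))"
  have lim: "filterlim (\<lambda>t. nat \<lceil>q t\<rceil>) sequentially at_top" unfolding q_def by real_asymp
  have "\<forall>\<^sub>F t::real in at_top. t > 1" "\<forall>\<^sub>F t in at_top. q t > 2" "\<forall>\<^sub>F t in at_top. ln (q t) \<ge> ln t / 4"
    unfolding q_def by real_asymp+
  then show ?thesis using eventually_compose_filterlim[OF low lim]
  proof eventually_elim
    case (elim t)
    define r where "r = nat \<lceil>q t\<rceil>"
    have r: "q t \<le> real r" "real r \<le> 2 * q t" "r \<ge> 1" using elim(2) unfolding r_def by linarith+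
    have lnt: "ln t > 0" using elim(1) by simp
    have t: "t = (q t)\<^sup>2 * ln t" using elim(1) lnt by (simp add: q_def)
    have d: "sqrt (t * ln t) = q t * ln t" unfolding q_def using elim(1) lnt
      by (simp add: real_sqrt_mult real_sqrt_divide field_simps)
    have "q t * (ln t / 4) \<le> real r * ln (real r)"
    proof (rule mult_mono)
      have "ln (q t) \<le> ln (real r)" using elim(2) r(1) by (intro ln_mono) auto
      then show "ln t / 4 \<le> ln (real r)" using elim(3) by linarith
    qed (use r elim(2) lnt in auto)
    then have s: "right_sum r \<ge> q t * ln t / 128" using elim(4) unfolding r_def by linarith
    have x: "q t * ln t / 128 > 0" using elim(2) lnt by simp
    have "p t \<le> 2 / right_sum r + 4 * real r / t"
      using elim(1) r(3) by (intro heat_kernel_upper) auto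
    also have "2 / right_sum r \<le> 2 / (q t * ln t / 128)"
      using s x by (intro divide_left_mono mult_pos_pos) auto
    also have "4 * real r / t \<le> 4 * (2 * q t) / t"
      using r(2) elim(1) by (intro divide_right_mono mult_left_mono) auto
    also have "2 / (q t * ln t / 128) + 4 * (2 * q t) / t = 264 / (q t * ln t)"
      using elim(2) lnt by (subst (3) t) (simp add: power2_eq_square field_simps)
    finally have "p t \<le> 264 * phi1 t" using elim(1) by (simp add: phi1_eq d)
    moreover have "phi1 t > 0" using elim(1,2) lnt by (simp add: phi1_eq d)
    ultimately show ?case by (simp add: divide_simps)
  qed
qed

text \<open>Time is a function of \<open>k\<close> here: \<open>4 * t\<close> is exactly
  \<open>k\<close> times the guaranteed volume \<open>k ln k / 32\<close>. With
  \<open>x = k ln k\<close> the two-sided volume is at most \<open>48 x\<close>, so the heat kernel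
  is at least \<open>1 / (384 x)\<close>; further \<open>x \<le> 12 sqrt (t ln t)\<close> because
  \<open>128 \<le> 12^2\<close>, and \<open>4608 = 384 * 12\<close>.\<close>

lemma frequently_heat_kernel_lower:
  assumes low: "\<forall>\<^sub>F n in sequentially. right_sum n \<ge> real n * ln (real n) / 32"
      "\<forall>\<^sub>F n in sequentially. left_sum n \<ge> real n * ln (real n) / 32"
    and up: "\<exists>\<^sub>F k in sequentially. right_sum (2 * k) \<le> 6 * real (2 * k) * ln (real (2 * k)) \<and>
      left_sum (2 * k) \<le> 6 * real (2 * k) * ln (real (2 * k))"
  shows "\<exists>\<^sub>F t in at_top. p t / phi1 t \<ge> 1 / 4608"
proof (rule frequently_filterlim)
  let ?t = "\<lambda>k. (real k)\<^sup>2 * ln (real k) / 128"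
  show "filterlim ?t at_top sequentially" by real_asymp
  have "\<forall>\<^sub>F k in sequentially. real k > 2" "\<forall>\<^sub>F k in sequentially. ?t k \<ge> real k" by real_asymp+
  then have "\<forall>\<^sub>F k in sequentially. (right_sum (2 * k) \<le> 6 * real (2 * k) * ln (real (2 * k)) \<and>
      left_sum (2 * k) \<le> 6 * real (2 * k) * ln (real (2 * k))) \<longrightarrow> p (?t k) / phi1 (?t k) \<ge> 1 / 4608"
    using low
  proof eventually_elim
    case (elim k)
    define t where "t = ?t k"
    define x where "x = real k * ln (real k)"
    have lnk: "ln (real k) > 0" using elim(1) by simp
    have x: "x > 0" using elim(1) lnk by (simp add: x_def)
    have t: "t > 2" using elim(1,2) by (simp add: t_def)
    show ?case
    proof (intro impI, elim conjE)
      assume u: "right_sum (2 * k) \<le> 6 * real (2 * k) * ln (real (2 * k))"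
        "left_sum (2 * k) \<le> 6 * real (2 * k) * ln (real (2 * k))"
      have "ln (real (2 * k)) \<le> ln ((real k)\<^sup>2)"
        using elim(1) by (subst ln_le_cancel_iff) (auto simp: power2_eq_square)
      also have "\<dots> = 2 * ln (real k)" using elim(1) by (simp add: ln_realpow)
      finally have "6 * real (2 * k) * ln (real (2 * k)) \<le> 6 * real (2 * k) * (2 * ln (real k))"
        by (intro mult_left_mono) auto
      then have V: "right_sum (2 * k) + left_sum (2 * k) \<le> 48 * x"
        using u by (simp add: x_def)
      have tt: "4 * t = real k * (real k * ln (real k) / 32)" by (simp add: t_def power2_eq_square)
      have pos: "right_sum (2 * k) > 0" "left_sum (2 * k) > 0"
        using elim(1) depth_pos by (auto intro!: sum_pos simp: lessThan_empty_iff)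
      have "1 / (8 * (48 * x)) \<le> 1 / (8 * (right_sum (2 * k) + left_sum (2 * k)))"
        using V pos x by (intro divide_left_mono) auto
      also have "\<dots> \<le> p t"
        using elim t by (intro heat_kernel_lower) (auto simp: tt intro!: mult_left_mono)
      finally have low: "1 / (384 * x) \<le> p t" by simp
      have "(x / 12)\<^sup>2 \<le> x\<^sup>2 / 128" by (simp add: power2_eq_square field_simps)
      also have "\<dots> = t * ln (real k)" by (simp add: x_def t_def power2_eq_square)
      also have "\<dots> \<le> t * ln t" using t elim by (intro mult_left_mono) (auto simp: t_def)
      finally have "x / 12 \<le> sqrt (t * ln t)" using x by (intro real_le_rsqrt)
      then have "1 / (384 * x) * (x / 12) \<le> p t * sqrt (t * ln t)"
        using low x t heat_kernel_nonneg[of t] by (intro mult_mono) auto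
      then have "1 / 4608 \<le> p t / phi1 t" using x t by (simp add: phi1_eq)
      then show "1 / 4608 \<le> p (?t k) / phi1 (?t k)" by (simp add: t_def)
    qed
  qed
  then show "\<exists>\<^sub>F k in sequentially. p (?t k) / phi1 (?t k) \<ge> 1 / 4608"
    by (rule frequently_rev_mp[OF up])
qed

text \<open>For \<open>k\<close> about \<open>32 q\<close>, \<open>k\<close> times the guaranteed
  volume is at least \<open>8 t\<close>, since \<open>ln k \<ge> ln t / 4\<close>. Then
  \<open>n = 2 k \<le> 66 q\<close>, each side has volume at most
  \<open>8 * 66 * q ln t (ln ln t)^2\<close>, and \<open>8448 = 8 * 2 * 8 * 66\<close>.\<close>

lemma eventually_heat_kernel_lower:
  assumes low: "\<forall>\<^sub>F n in sequentially. right_sum n \<ge> real n * ln (real n) / 32"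
      "\<forall>\<^sub>F n in sequentially. left_sum n \<ge> real n * ln (real n) / 32"
    and up: "\<forall>\<^sub>F n in sequentially. right_sum n \<le> 8 * real n * ln (real n) * (ln (ln (real n)))\<^sup>2"
      "\<forall>\<^sub>F n in sequentially. left_sum n \<le> 8 * real n * ln (real n) * (ln (ln (real n)))\<^sup>2"
  shows "\<forall>\<^sub>F t in at_top. p t / phi1 t \<ge> 1 / (8448 * (ln (ln t))\<^sup>2)"
proof -
  define q where "q = (\<lambda>t::real. sqrt (t / ln t))"
  have lim: "filterlim (\<lambda>t. nat \<lceil>32 * q t\<rceil>) sequentially at_top"
    and lim2: "filterlim (\<lambda>t. 2 * nat \<lceil>32 * q t\<rceil>) sequentially at_top"
    unfolding q_def by real_asymp+
  have "\<forall>\<^sub>F t::real in at_top. t > 1" "\<forall>\<^sub>F t in at_top. q t > 2" "\<forall>\<^sub>F t in at_top. ln (q t) \<ge> ln t / 4"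
    "\<forall>\<^sub>F t in at_top. 66 * q t \<le> t" "\<forall>\<^sub>F t::real in at_top. ln (ln t) > 0"
    unfolding q_def by real_asymp+
  then show ?thesis
    using eventually_compose_filterlim[OF low(1) lim] eventually_compose_filterlim[OF low(2) lim]
      eventually_compose_filterlim[OF up(1) lim2] eventually_compose_filterlim[OF up(2) lim2]
  proof eventually_elim
    case (elim t)
    define k where "k = nat \<lceil>32 * q t\<rceil>"
    have k: "32 * q t \<le> real k" "real k \<le> 33 * q t" "k \<ge> 64" using elim(2) unfolding k_def by linarith+
    have lnt: "ln t > 0" using elim(1) by simp
    have t: "t = (q t)\<^sup>2 * ln t" using elim(1) lnt by (simp add: q_def)
    have d: "sqrt (t * ln t) = q t * ln t" unfolding q_def using elim(1) lnt
      by (simp add: real_sqrt_mult real_sqrt_divide field_simps)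
    have "ln (q t) \<le> ln (real k)" using elim(2) k(1) by (intro ln_mono) auto
    then have lnk: "ln t / 4 \<le> ln (real k)" using elim(3) by linarith
    have "(32 * q t) * ((32 * q t) * (ln t / 4) / 32) \<le> real k * (real k * ln (real k) / 32)"
      using k(1) lnk elim(2) lnt by (intro mult_mono divide_right_mono) auto
    also have "(32 * q t) * ((32 * q t) * (ln t / 4) / 32) = 8 * t"
      by (subst (3) t) (simp add: power2_eq_square)
    finally have kk: "4 * t \<le> real k * (real k * ln (real k) / 32)" using elim(1) by linarith
    define n where "n = 2 * k"
    have n: "real n \<le> 66 * q t" "real n \<le> t" "real n \<ge> 128" using k elim(4) by (auto simp: n_def)
    \<comment> \<open>This makes \<open>ln (ln n)\<close> positive, so that squaring preserves its
      comparison with \<open>ln (ln t)\<close>.\<close>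
    have e_lt: "exp 1 < real n" using exp_le n(3) by linarith
    have l1: "ln (real n) \<le> ln t" "1 < ln (real n)"
      using n(2,3) e_lt by (auto simp: ln_le_cancel_iff) (metis exp_gt_zero ln_exp ln_less_cancel_iff less_trans)
    have l2: "ln (ln (real n)) \<le> ln (ln t)" "0 < ln (ln (real n))" using l1 by (auto intro!: ln_mono)
    have b: "8 * real n * ln (real n) * (ln (ln (real n)))\<^sup>2 \<le> 8 * (66 * q t) * ln t * (ln (ln t))\<^sup>2"
      using n(1) l1 l2 elim(2) by (intro mult_mono power_mono) auto
    have V: "right_sum n + left_sum n \<le> 1056 * (q t * ln t) * (ln (ln t))\<^sup>2"
    proof -
      have "right_sum n \<le> 8 * (66 * q t) * ln t * (ln (ln t))\<^sup>2" "left_sum n \<le> 8 * (66 * q t) * ln t * (ln (ln t))\<^sup>2"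
        using elim(8,9) b unfolding n_def k_def by (blast intro: order_trans)+
      then show ?thesis by (simp add: mult_ac)
    qed
    have pos: "right_sum n > 0" "left_sum n > 0"
      using n(3) depth_pos by (auto intro!: sum_pos simp: lessThan_empty_iff)
    have "1 / (8 * (1056 * (q t * ln t) * (ln (ln t))\<^sup>2)) \<le> 1 / (8 * (right_sum n + left_sum n))"
      using V pos elim(2,5) lnt by (intro divide_left_mono) auto
    also have "\<dots> \<le> p t" unfolding n_def
    proof (rule heat_kernel_lower)
      show "4 * t \<le> real k * right_sum k" "4 * t \<le> real k * left_sum k"
        using kk elim(6,7) by (auto simp: k_def intro!: order_trans[OF kk[unfolded k_def]] mult_left_mono)
    qed (use k elim(1) in auto)
    finally have "1 / (8448 * (ln (ln t))\<^sup>2) / (q t * ln t) \<le> p t" by (simp add: mult_ac)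
    moreover have "q t * ln t > 0" using elim(2) lnt by simp
    ultimately have "1 / (8448 * (ln (ln t))\<^sup>2) \<le> p t * (q t * ln t)" by (simp only: pos_divide_le_eq)
    then show ?case using elim(1) by (simp add: phi1_eq d)
  qed
qed

text \<open>With a trap deeper than \<open>v\<close> at site \<open>n\<close>, the time
  \<open>t = n v\<close> makes both terms of the upper bound of order \<open>1 / v\<close>, in total
  at most \<open>10 / v\<close>. Since \<open>v\<close> is linear in \<open>C\<close> and
  \<open>sqrt (t ln t ln ln t)\<close> grows only like \<open>sqrt C\<close>, the ratio gains
  \<open>1 / sqrt C\<close>.\<close>

lemma frequently_heat_kernel_upper:
  assumes C: "C > 0"
    and large: "\<exists>\<^sub>F n in sequentially. e (int n) > C * (real n * ln (real n) * ln (ln (real n)))"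
  shows "\<exists>\<^sub>F t in at_top. p t * ln (ln t) powr (1/2) / phi1 t \<le> 30 / sqrt C"
proof (rule frequently_filterlim)
  let ?t = "\<lambda>n. real n * (C * (real n * ln (real n) * ln (ln (real n))))"
  show "filterlim ?t at_top sequentially" using C by real_asymp
  have "\<forall>\<^sub>F n in sequentially. ln (ln (real n)) > 0" "\<forall>\<^sub>F n in sequentially. real n > 3"
    "\<forall>\<^sub>F n in sequentially. ?t n > 3" "\<forall>\<^sub>F n in sequentially. ln (?t n) \<le> 4 * ln (real n)"
    "\<forall>\<^sub>F n::nat in sequentially. ln (4 * ln (real n)) \<le> 2 * ln (ln (real n))"
    using C by real_asymp+
  then have "\<forall>\<^sub>F n in sequentially. e (int n) > C * (real n * ln (real n) * ln (ln (real n))) \<longrightarrow>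
    p (?t n) * ln (ln (?t n)) powr (1/2) / phi1 (?t n) \<le> 30 / sqrt C"
  proof eventually_elim
    case (elim n)
    define t where "t = ?t n"
    define L where "L = ln (ln (real n))"
    define x where "x = real n * ln (real n)"
    define v where "v = C * (x * L)"
    have lnn: "ln (real n) > 0" using elim(2) by simp
    have L: "L > 0" using elim(1) by (simp add: L_def)
    have x: "x > 0" using elim(2) lnn by (simp add: x_def)
    have v: "v > 0" using x L C by (simp add: v_def)
    have t: "t > 3" "t = real n * v" using elim(3) by (auto simp: t_def v_def x_def L_def)
    have lnt: "ln t > 1"
    proof -
      have "exp 1 < t" using exp_le t(1) by linarith
      then show ?thesis using t(1) by (metis exp_gt_zero ln_exp ln_less_cancel_iff less_trans)
    qed
    show ?case
    proof
      assume big: "e (int n) > C * (real n * ln (real n) * ln (ln (real n)))"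
      then have "v \<le> e (int n)" by (simp add: v_def x_def L_def)
      also have "\<dots> \<le> right_sum (n + 1)" using depth_pos by (auto intro!: sum_nonneg intro: less_imp_le)
      finally have s: "v \<le> right_sum (n + 1)" .
      have "p t \<le> 2 / right_sum (n + 1) + 4 * real (n + 1) / t"
        using t(1) by (intro heat_kernel_upper) auto
      also have "2 / right_sum (n + 1) \<le> 2 / v"
        using s v by (intro divide_left_mono mult_pos_pos) auto
      also have "4 * real (n + 1) / t \<le> 4 * (2 * real n) / t"
        using t(1) elim(2) by (intro divide_right_mono) auto
      also have "\<dots> = 8 / v" using elim(2) unfolding t(2) by simp
      finally have p: "p t \<le> 10 / v" by simp
      have "ln (ln t) \<le> ln (4 * ln (real n))"
        using elim(4) lnt lnn by (intro ln_mono) (auto simp: t_def)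
      also have "\<dots> \<le> 2 * L" using elim(5) by (simp add: L_def)
      finally have ll: "ln (ln t) \<le> 2 * L" .
      have "t * ln t * ln (ln t) \<le> t * (4 * ln (real n)) * (2 * L)"
        using t(1) elim(4) lnt ll lnn by (intro mult_mono) (auto simp: t_def)
      also have "\<dots> = 8 * C * (x * L)\<^sup>2" by (simp add: t(2) v_def x_def power2_eq_square)
      also have "\<dots> \<le> 9 * C * (x * L)\<^sup>2" using C by (intro mult_right_mono) auto
      finally have "sqrt (t * ln t * ln (ln t)) \<le> sqrt (9 * C * (x * L)\<^sup>2)" by simp
      also have "\<dots> = 3 * sqrt C * (x * L)" using x L by (simp add: real_sqrt_mult)
      finally have sq: "sqrt (t * ln t * ln (ln t)) \<le> 3 * sqrt C * (x * L)" .
      have "p t * ln (ln t) powr (1/2) / phi1 t = p t * sqrt (t * ln t * ln (ln t))"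
        using t(1) lnt by (simp add: phi1_eq powr_half_sqrt real_sqrt_mult)
      also have "\<dots> \<le> 10 / v * (3 * sqrt C * (x * L))"
        using p sq v t(1) lnt by (intro mult_mono) auto
      also have "\<dots> = 30 * (sqrt C / C)" using x L by (simp add: v_def)
      also have "\<dots> = 30 / sqrt C" using C by (simp add: real_div_sqrt field_simps)
      finally show "p (?t n) * ln (ln (?t n)) powr (1/2) / phi1 (?t n) \<le> 30 / sqrt C" by (simp add: t_def)
    qed
  qed
  then show "\<exists>\<^sub>F n in sequentially. p (?t n) * ln (ln (?t n)) powr (1/2) / phi1 (?t n) \<le> 30 / sqrt C"
    by (rule frequently_rev_mp[OF large])
qed

end

theorem mainTheorem2:
  fixes M :: "'a measure" and \<tau> :: "int \<Rightarrow> 'a \<Rightarrow> real"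
  assumes "prob_space M"
    and "prob_space.indep_vars M (\<lambda>_. borel) \<tau> UNIV"
    and "\<And>x u. u \<ge> 1 \<Longrightarrow> measure M {\<omega> \<in> space M. \<tau> x \<omega> > u} = u powr (-1)"
  shows "AE \<omega> in M.
    0 < Limsup at_top (\<lambda>t. ereal (trap_heat_kernel (\<lambda>x. \<tau> x \<omega>) t 0 0 / phi1 t))
  \<and> Limsup at_top (\<lambda>t. ereal (trap_heat_kernel (\<lambda>x. \<tau> x \<omega>) t 0 0 / phi1 t)) < \<infinity>
  \<and> Liminf at_top (\<lambda>t. ereal (trap_heat_kernel (\<lambda>x. \<tau> x \<omega>) t 0 0
        * ln (ln t) powr (1/2) / phi1 t)) = 0
  \<and> (\<forall>\<theta>::real. \<theta> > 3 \<longrightarrow>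
      Liminf at_top (\<lambda>t. ereal (trap_heat_kernel (\<lambda>x. \<tau> x \<omega>) t 0 0
        * ln (ln t) powr \<theta> / phi1 t)) = \<infinity>)"
proof -
  interpret prob_space M by fact
  have seq: "pareto_sequence M (\<lambda>i. \<tau> (f i))" if "inj f" for f :: "nat \<Rightarrow> int"
  proof (intro pareto_sequence.intro pareto_sequence_axioms.intro)
    show "prob_space M" by fact
    show "indep_vars (\<lambda>_. borel) (\<lambda>i. \<tau> (f i)) UNIV"
      using indep_vars_reindex[of f UNIV "\<lambda>_. borel" \<tau>] that indep_vars_subset[OF assms(2), of "range f"]
      by simp
    show "prob {\<omega> \<in> space M. u < \<tau> (f i) \<omega>} = 1 / u" if "1 \<le> u" for u i
      using assms(3)[OF that, of "f i"] that by (simp add: powr_minus_divide)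
  qed
  \<comment> \<open>Both half-lines contain the origin, so the two sequences share a depth. They are
    combined through almost sure statements only, which hold jointly.\<close>
  interpret R: pareto_sequence M "\<lambda>i. \<tau> (int i)" by (rule seq) (simp add: inj_on_def)
  interpret L: pareto_sequence M "\<lambda>i. \<tau> (- int i)" by (rule seq) (simp add: inj_on_def)
  from R.AE_Y_gt_1 L.AE_Y_gt_1 R.AE_S_lower L.AE_S_lower R.AE_S_upper L.AE_S_upper
    R.AE_S_upper_subseq L.AE_S_upper_subseq R.AE_frequently_large
  show ?thesis
  proof eventually_elim
    case (elim \<omega>)
    have "1 \<le> \<tau> x \<omega>" for x
      using elim(1,2) by (cases x rule: int_cases2) (auto intro: less_imp_le)
    then interpret trap_environment "\<lambda>x. \<tau> x \<omega>" by unfold_locales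
    let ?p = "\<lambda>t. trap_heat_kernel (\<lambda>x. \<tau> x \<omega>) t 0 0"
    let ?X = "\<lambda>t. ?p t * ln (ln t) powr (1/2) / phi1 t"
    have "Limsup at_top (\<lambda>t. ereal (?p t / phi1 t)) \<le> ereal 264"
      by (rule Limsup_bounded) (use eventually_heat_kernel_upper[OF elim(3)] in simp)
    then have lim_fin: "Limsup at_top (\<lambda>t. ereal (?p t / phi1 t)) < \<infinity>" by (auto simp: le_less_trans)
    have lim_pos: "0 < Limsup at_top (\<lambda>t. ereal (?p t / phi1 t))"
    proof (rule ccontr)
      assume "\<not> ?thesis"
      then have "Limsup at_top (\<lambda>t. ereal (?p t / phi1 t)) < ereal (1 / 4608)"
        by (simp add: not_less le_less_trans)
      then have "\<forall>\<^sub>F t in at_top. ereal (?p t / phi1 t) < ereal (1 / 4608)" by (rule Limsup_lessD)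
      then have ev: "\<forall>\<^sub>F t in at_top. \<not> ?p t / phi1 t \<ge> 1 / 4608" by (simp add: not_le)
      \<comment> \<open>The lower bound at \<open>k\<close> involves the volume of
        \<open>2 * k\<close> sites, so \<open>2 * k\<close> is made one of the good scales
        \<open>2 ^ (m^2)\<close>.\<close>
      let ?g = "\<lambda>m::nat. 2 ^ (m\<^sup>2 - 1) :: nat"
      have "\<exists>\<^sub>F k in sequentially.
          (\<Sum>i<2 * k. \<tau> (int i) \<omega>) \<le> 6 * real (2 * k) * ln (real (2 * k)) \<and>
          (\<Sum>i<2 * k. \<tau> (- int i) \<omega>) \<le> 6 * real (2 * k) * ln (real (2 * k))"
      proof (rule frequently_filterlim)
        show "filterlim ?g sequentially sequentially"
        proof (rule filterlim_at_top_mono[OF filterlim_ident])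
          show "\<forall>\<^sub>F m in sequentially. m \<le> ?g m"
            using eventually_ge_at_top[of 1]
          proof eventually_elim
            case (elim m)
            then have "m \<le> m\<^sup>2 - 1 + 1" by (simp add: power2_eq_square)
            also have "m\<^sup>2 - 1 + 1 \<le> ?g m" using less_exp[of "m\<^sup>2 - 1"] by linarith
            finally show ?case .
          qed
        qed
        have "\<forall>\<^sub>F m in sequentially.
          (\<Sum>i<2 * ?g m. \<tau> (int i) \<omega>) \<le> 6 * real (2 * ?g m) * ln (real (2 * ?g m)) \<and>
          (\<Sum>i<2 * ?g m. \<tau> (- int i) \<omega>) \<le> 6 * real (2 * ?g m) * ln (real (2 * ?g m))"
          using elim(7,8) eventually_ge_at_top[of 1]
        proof eventually_elim
          case inner: (elim m)
          have "2 * ?g m = 2 ^ (m\<^sup>2)" using inner(3) by (simp flip: power_Suc)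
          then show ?case using inner(1,2) by metis
        qed
        then show "\<exists>\<^sub>F m in sequentially.
          (\<Sum>i<2 * ?g m. \<tau> (int i) \<omega>) \<le> 6 * real (2 * ?g m) * ln (real (2 * ?g m)) \<and>
          (\<Sum>i<2 * ?g m. \<tau> (- int i) \<omega>) \<le> 6 * real (2 * ?g m) * ln (real (2 * ?g m))"
          by (rule eventually_frequently[rotated]) simp
      qed
      from frequently_heat_kernel_lower[OF elim(3,4) this] ev show False
        by (simp add: frequently_def)
    qed
    have inf0: "Liminf at_top (\<lambda>t. ereal (?X t)) = 0"
    proof (rule antisym)
      show "0 \<le> Liminf at_top (\<lambda>t. ereal (?X t))"
      proof (rule Liminf_bounded)
        show "\<forall>\<^sub>F t in at_top. 0 \<le> ereal (?X t)"
          using eventually_ge_at_top[of 0]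
          by eventually_elim (simp add: heat_kernel_nonneg phi1_nonneg)
      qed
      show "Liminf at_top (\<lambda>t. ereal (?X t)) \<le> 0"
      proof (rule ccontr)
        assume "\<not> ?thesis"
        then obtain y where y: "0 < ereal y" "ereal y < Liminf at_top (\<lambda>t. ereal (?X t))"
          using ereal_dense2[of 0] by (auto simp: not_le)
        then have ev: "\<forall>\<^sub>F t in at_top. y < ?X t" using less_LiminfD[OF y(2)] by simp
        \<comment> \<open>\<open>30 / sqrt (C + 1) \<le> y\<close> amounts to
          \<open>C + 1 \<ge> (30 / y)^2\<close>.\<close>
        obtain C :: nat where C: "(30 / y)\<^sup>2 < real C" using reals_Archimedean2 by blast
        have "30 / y \<le> sqrt (real C + 1)" using C by (intro real_le_rsqrt) linarith
        then have "30 / sqrt (real C + 1) \<le> y" using y(1) by (simp add: field_simps)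
        moreover have "\<exists>\<^sub>F t in at_top. ?X t \<le> 30 / sqrt (real C + 1)"
          using elim(9) by (intro frequently_heat_kernel_upper) auto
        ultimately have "\<exists>\<^sub>F t in at_top. \<not> y < ?X t" by (auto elim!: frequently_elim1)
        with ev show False by (simp add: frequently_def)
      qed
    qed
    have "Liminf at_top (\<lambda>t. ereal (?p t * ln (ln t) powr \<theta> / phi1 t)) = \<infinity>" if "\<theta> > 3" for \<theta> :: real
    proof -
      \<comment> \<open>The lower bound valid at all large times loses \<open>(ln ln t)^2\<close>;
        the power \<open>\<theta> - 2\<close> that remains is positive.\<close>
      have "filterlim (\<lambda>t::real. ln (ln t) powr (\<theta> - 2) / 8448) at_top at_top"
        using that by real_asymp
      moreover have "\<forall>\<^sub>F t in at_top. ln (ln t) powr (\<theta> - 2) / 8448 \<le> ?p t * ln (ln t) powr \<theta> / phi1 t"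
      proof -
        have "\<forall>\<^sub>F t::real in at_top. ln (ln t) > 0" by real_asymp
        with eventually_heat_kernel_lower[OF elim(3-6)] show ?thesis
        proof eventually_elim
          case inner: (elim t)
          have "ln (ln t) powr (\<theta> - 2) / 8448 = 1 / (8448 * (ln (ln t))\<^sup>2) * ln (ln t) powr \<theta>"
            using inner(2) by (simp add: powr_diff)
          also have "\<dots> \<le> ?p t / phi1 t * ln (ln t) powr \<theta>"
            using inner(1) by (intro mult_right_mono) auto
          finally show ?case by simp
        qed
      qed
      ultimately have "filterlim (\<lambda>t. ?p t * ln (ln t) powr \<theta> / phi1 t) at_top at_top"
        by (rule filterlim_at_top_mono)
      then show ?thesis
        by (simp add: tendsto_PInfty_eq_at_top flip: Liminf_PInfty)
    qed
    then show ?case using lim_pos lim_fin inf0 by blast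
  qed
qed

end
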